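(* Let $N\ge2$, $\alpha,\beta\in\{x,y,z\}$ with $\alpha\ne\beta$, and consider the transverse-field Ising Hamiltonian $$H(t)=\sum_{i=1}^{N-1}J_i^\alpha(t)\,\sigma_i^\alpha\sigma_{i+1}^\alpha+\sum_{i=1}^{N}h_i^\beta(t)\,\sigma_i^\beta$$ with real coefficients. Let $\Delta t>0$, let $n_t>N$ be an integer, $t_\tau=t_0+\tau\Delta t$, and let $$U(n_t\Delta t)=U_{n_t}\cdots U_2U_1,\qquad U_\tau=\prod_{i=1}^{N-1}R_i^{\alpha\alpha}(2J_i^\alpha(t_\tau)\Delta t)\ \prod_{i=1}^{N}R_i^\beta(2h_i^\beta(t_\tau)\Delta t).$$ Then $U(n_t\Delta t)$ is equal to the operator of a TFIM square circuit on $N$ spins, and also to the operator of a TFIM triangle circuit on $N$ spins. Each of these contains $N(2N-1)$ gates in total, of which $N^2$ are one-spin Pauli rotations $R_i^\beta$ and $N(N-1)$ are two-spin Pauli rotations $R_i^{\alpha\alpha}$. Moreover, every TFIM square circuit is equal as an operator to a TFIM triangle circuit and vice versa.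
   Context: $\sigma^x,\sigma^y,\sigma^z$ are the Pauli matrices, and $\sigma_i^\alpha=I^{\otimes(i-1)}\otimes\sigma^\alpha\otimes I^{\otimes(N-i)}$ on $(\mathbb C^2)^{\otimes N}$. $R_i^\beta(\theta)=\exp(-\mathrm{i}\,\sigma_i^\beta\,\theta/2)$ for $1\le i\le N$ and $R_i^{\alpha\alpha}(\theta)=\exp(-\mathrm{i}\,\sigma_i^\alpha\sigma_{i+1}^\alpha\,\theta/2)$ for $1\le i\le N-1$. A circuit is a time-ordered sequence of gates $g_1,\dots,g_m$ (first to last) with operator $g_m\cdots g_1$. Label slots $1,\dots,2N-1$: a gate in slot $2j-1$ ($1\le j\le N$) is some $R_j^\beta(\theta)$, and a gate in slot $2j$ ($1\le j\le N-1$) is some $R_j^{\alpha\alpha}(\theta)$, with arbitrary real $\theta$. A TFIM square circuit on $N$ spins consists of $N$ successive blocks, each block being, in time order, one gate in every odd slot followed by one gate in every even slot. A TFIM triangle circuit on $N$ spins consists, in time order, of $2N-1$ cascades, the $k$-th ($1\le k\le 2N-1$) containing $k$ gates in slots $2N-k,\,2N-k+1,\dots,2N-1$ in this time order. *)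

theory Defs
  imports Complex_Main "Jordan_Normal_Form.Matrix"
begin

datatype pauli = PX | PY | PZ

fun pauli_mat :: "pauli \<Rightarrow> complex mat" where
  "pauli_mat PX = mat_of_rows_list 2 [[0, 1], [1, 0]]"
| "pauli_mat PY = mat_of_rows_list 2 [[0, - \<i>], [\<i>, 0]]"
| "pauli_mat PZ = mat_of_rows_list 2 [[1, 0], [0, - 1]]"

text \<open>Kronecker product; the left factor carries the most significant digit of the index, so
  that \<open>(\<complex>\<^sup>2)\<close> tensored \<open>N\<close> times is \<open>\<complex>\<close> to the power \<open>2 ^ N\<close> in the computational basis.\<close>

definition kron :: "complex mat \<Rightarrow> complex mat \<Rightarrow> complex mat" where
  "kron A B = mat (dim_row A * dim_row B) (dim_col A * dim_col B)
     (\<lambda>(i, j). A $$ (i div dim_row B, j div dim_col B) * B $$ (i mod dim_row B, j mod dim_col B))"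

definition tensor_list :: "complex mat list \<Rightarrow> complex mat" where
  "tensor_list As = foldr kron As (1\<^sub>m 1)"

text \<open>\<open>mat_prod n [A\<^sub>1, \<dots>, A\<^sub>m]\<close> is \<open>A\<^sub>1 \<cdots> A\<^sub>m\<close>, and \<open>mat_sum\<close> is the corresponding sum.\<close>

definition mat_prod :: "nat \<Rightarrow> complex mat list \<Rightarrow> complex mat" where
  "mat_prod n As = foldr (*) As (1\<^sub>m n)"

definition mat_sum :: "nat \<Rightarrow> complex mat list \<Rightarrow> complex mat" where
  "mat_sum n As = foldr (+) As (0\<^sub>m n n)"

text \<open>The power series of the exponential, summed entrywise (it converges for every square
  matrix); the matrix type carries no norm, so the library's \<open>exp\<close> does not apply to it.\<close>

definition mat_exp :: "complex mat \<Rightarrow> complex mat" where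
  "mat_exp A = mat (dim_row A) (dim_row A) (\<lambda>(i, j). \<Sum>k. (A ^\<^sub>m k) $$ (i, j) / fact k)"

definition sigma :: "nat \<Rightarrow> pauli \<Rightarrow> nat \<Rightarrow> complex mat" where
  "sigma N a i =
     tensor_list (replicate (i - 1) (1\<^sub>m 2) @ [pauli_mat a] @ replicate (N - i) (1\<^sub>m 2))"

definition tfim_hamiltonian ::
  "nat \<Rightarrow> pauli \<Rightarrow> pauli \<Rightarrow> (nat \<Rightarrow> real \<Rightarrow> real) \<Rightarrow> (nat \<Rightarrow> real \<Rightarrow> real) \<Rightarrow> real \<Rightarrow> complex mat" where
  "tfim_hamiltonian N \<alpha> \<beta> J h t =
     mat_sum (2 ^ N)
       (map (\<lambda>i. complex_of_real (J i t) \<cdot>\<^sub>m (sigma N \<alpha> i * sigma N \<alpha> (i + 1))) [1..<N])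
   + mat_sum (2 ^ N) (map (\<lambda>i. complex_of_real (h i t) \<cdot>\<^sub>m sigma N \<beta> i) [1..<N + 1])"

text \<open>Gates are kept symbolic so that they can be counted: \<open>Rot1 b i \<theta>\<close> stands for the one-spin
  rotation on spin \<open>i\<close>, \<open>Rot2 a i \<theta>\<close> for the two-spin rotation on spins \<open>i\<close> and \<open>i + 1\<close>.\<close>

datatype gate = Rot1 pauli nat real | Rot2 pauli nat real

fun gate_op :: "nat \<Rightarrow> gate \<Rightarrow> complex mat" where
  "gate_op N (Rot1 b i \<theta>) = mat_exp ((- \<i> * complex_of_real \<theta> / 2) \<cdot>\<^sub>m sigma N b i)"
| "gate_op N (Rot2 a i \<theta>) =
     mat_exp ((- \<i> * complex_of_real \<theta> / 2) \<cdot>\<^sub>m (sigma N a i * sigma N a (i + 1)))"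

text \<open>Circuits are lists of gates, first gate at the head; the operator of
  \<open>[g\<^sub>1, \<dots>, g\<^sub>m]\<close> is \<open>g\<^sub>m \<cdots> g\<^sub>1\<close>.\<close>

definition circuit_op :: "nat \<Rightarrow> gate list \<Rightarrow> complex mat" where
  "circuit_op N c = mat_prod (2 ^ N) (rev (map (gate_op N) c))"

definition gate_in_slot :: "nat \<Rightarrow> pauli \<Rightarrow> pauli \<Rightarrow> nat \<Rightarrow> gate \<Rightarrow> bool" where
  "gate_in_slot N \<alpha> \<beta> s g \<longleftrightarrow>
     (\<exists>j\<in>{1..N}. \<exists>\<theta>. s = 2 * j - 1 \<and> g = Rot1 \<beta> j \<theta>) \<or>
     (\<exists>j\<in>{1..N - 1}. \<exists>\<theta>. s = 2 * j \<and> g = Rot2 \<alpha> j \<theta>)"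

text \<open>One gate in every slot of \<open>S\<close>, in any order.\<close>

definition layer :: "nat \<Rightarrow> pauli \<Rightarrow> pauli \<Rightarrow> nat set \<Rightarrow> gate list \<Rightarrow> bool" where
  "layer N \<alpha> \<beta> S c \<longleftrightarrow>
     (\<exists>ss. distinct ss \<and> set ss = S \<and> list_all2 (gate_in_slot N \<alpha> \<beta>) ss c)"

definition square_block :: "nat \<Rightarrow> pauli \<Rightarrow> pauli \<Rightarrow> gate list \<Rightarrow> bool" where
  "square_block N \<alpha> \<beta> c \<longleftrightarrow>
     (\<exists>c1 c2. c = c1 @ c2 \<and>
        layer N \<alpha> \<beta> {s \<in> {1..2 * N - 1}. odd s} c1 \<and>
        layer N \<alpha> \<beta> {s \<in> {1..2 * N - 1}. even s} c2)"

definition square_circuit :: "nat \<Rightarrow> pauli \<Rightarrow> pauli \<Rightarrow> gate list \<Rightarrow> bool" where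
  "square_circuit N \<alpha> \<beta> c \<longleftrightarrow>
     (\<exists>bs. c = concat bs \<and> length bs = N \<and> (\<forall>b\<in>set bs. square_block N \<alpha> \<beta> b))"

definition cascade :: "nat \<Rightarrow> pauli \<Rightarrow> pauli \<Rightarrow> nat \<Rightarrow> gate list \<Rightarrow> bool" where
  "cascade N \<alpha> \<beta> k c \<longleftrightarrow> list_all2 (gate_in_slot N \<alpha> \<beta>) [2 * N - k..<2 * N] c"

definition triangle_circuit :: "nat \<Rightarrow> pauli \<Rightarrow> pauli \<Rightarrow> gate list \<Rightarrow> bool" where
  "triangle_circuit N \<alpha> \<beta> c \<longleftrightarrow>
     (\<exists>bs. c = concat bs \<and> list_all2 (cascade N \<alpha> \<beta>) [1..<2 * N] bs)"

text \<open>\<open>trotter_step\<close> is \<open>U\<^sub>\<tau>\<close> as a function of the time \<open>t\<close>, which is \<open>t\<^sub>\<tau> = t0 + \<tau> \<Delta>t\<close> in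
  \<open>trotter_evolution\<close>.\<close>

definition trotter_step ::
  "nat \<Rightarrow> pauli \<Rightarrow> pauli \<Rightarrow> (nat \<Rightarrow> real \<Rightarrow> real) \<Rightarrow> (nat \<Rightarrow> real \<Rightarrow> real) \<Rightarrow> real \<Rightarrow> real \<Rightarrow> complex mat" where
  "trotter_step N \<alpha> \<beta> J h \<Delta>t t =
     mat_prod (2 ^ N) (map (\<lambda>i. gate_op N (Rot2 \<alpha> i (2 * J i t * \<Delta>t))) [1..<N])
   * mat_prod (2 ^ N) (map (\<lambda>i. gate_op N (Rot1 \<beta> i (2 * h i t * \<Delta>t))) [1..<N + 1])"

definition trotter_evolution ::
  "nat \<Rightarrow> pauli \<Rightarrow> pauli \<Rightarrow> (nat \<Rightarrow> real \<Rightarrow> real) \<Rightarrow> (nat \<Rightarrow> real \<Rightarrow> real) \<Rightarrow> real \<Rightarrow> real \<Rightarrow> nat \<Rightarrow> complex mat" where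
  "trotter_evolution N \<alpha> \<beta> J h t0 \<Delta>t nt =
     mat_prod (2 ^ N)
       (rev (map (\<lambda>\<tau>. trotter_step N \<alpha> \<beta> J h \<Delta>t (t0 + real \<tau> * \<Delta>t)) [1..<nt + 1]))"

end

theory Submission
  imports Defs
begin

text \<open>The generators \<open>P\<^sub>1, \<dots>, P\<^sub>n\<close>, \<open>n = 2 * N - 1\<close>, attached to the slots are involutions;
  neighbours anticommute and all other pairs commute. So gates in one slot fuse, gates in distant
  slots commute, and by Euler angles a product of gates in the slots \<open>s, s + 1, s\<close> can be rewritten
  with slots \<open>s + 1, s, s + 1\<close>. Hence the set of operators realised by a given word of slots depends
  only on the class of that word in the 0-Hecke monoid of type \<open>A\<^sub>n\<close>. There the triangle word is
  the longest element, which absorbs every further letter, so triangle circuits realise everything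
  that any circuit does. The square word, read along its diagonals, is a word for the same element.\<close>

section \<open>The 0-Hecke monoid\<close>

text \<open>Euler angles are only known to exist, so angles are never tracked along a rewriting. A
  word of slots stands for the whole set of operators obtained by varying all angles, and each
  rewriting rule becomes an equality of such sets. This is why the square of a letter is the letter
  itself and not the identity: two gates in one slot realise exactly what one gate realises.
  Absorption is proved for the triangle, where a letter can be pushed back through the last cascade
  and handed to a smaller triangle; the alternating layers of the square offer no such recursion.
  The square word is instead rewritten into the triangle word. Both have n (n + 1) / 2 = N (2 N - 1)
  letters, the length of the longest element, and accordingly the rewriting uses only commutations
  and braids; idempotence occurs only in the absorption.\<close>

inductive hecke_eq :: "nat list \<Rightarrow> nat list \<Rightarrow> bool" where
  refl: "hecke_eq u u"
| sym: "hecke_eq u v \<Longrightarrow> hecke_eq v u"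
| trans: "hecke_eq u v \<Longrightarrow> hecke_eq v w \<Longrightarrow> hecke_eq u w"
| congr: "hecke_eq u v \<Longrightarrow> hecke_eq (x @ u @ y) (x @ v @ y)"
| idem: "hecke_eq [s, s] [s]"
| commute: "Suc s < t \<Longrightarrow> hecke_eq [s, t] [t, s]"
| braid: "hecke_eq [s, Suc s, s] [Suc s, s, Suc s]"

declare hecke_eq.trans [trans]

lemma hecke_eq_prefix: "hecke_eq u v \<Longrightarrow> hecke_eq (x @ u) (x @ v)"
  using hecke_eq.congr[of u v x "[]"] by simp

lemma hecke_eq_suffix: "hecke_eq u v \<Longrightarrow> hecke_eq (u @ y) (v @ y)"
  using hecke_eq.congr[of u v "[]" y] by simp

lemma hecke_eq_Cons: "hecke_eq u v \<Longrightarrow> hecke_eq (a # u) (a # v)"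
  using hecke_eq_prefix[of u v "[a]"] by simp

lemma hecke_eq_commute_far: "Suc s < t \<or> Suc t < s \<Longrightarrow> hecke_eq [s, t] [t, s]"
  using hecke_eq.commute hecke_eq.sym by blast

lemma hecke_eq_commute_letter:
  assumes "\<And>b. b \<in> set u \<Longrightarrow> Suc a < b \<or> Suc b < a"
  shows "hecke_eq (u @ [a]) (a # u)"
  using assms
proof (induction u)
  case Nil
  show ?case by (simp add: hecke_eq.refl)
next
  case (Cons b u)
  have "hecke_eq (b # u @ [a]) (b # a # u)"
    using Cons by (intro hecke_eq_Cons) simp
  also have "hecke_eq (b # a # u) (a # b # u)"
    using hecke_eq_suffix[OF hecke_eq_commute_far[of b a], of u] Cons.prems[of b] by auto
  finally show ?case by simp
qed

text \<open>A cascade acts like a Coxeter element. The letter \<open>s\<close> moves left past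
  everything above \<open>Suc s\<close>, the braid relation turns \<open>s, Suc s, s\<close> into
  \<open>Suc s, s, Suc s\<close>, and the leading \<open>Suc s\<close> moves left past everything
  below \<open>s\<close>.\<close>

lemma hecke_eq_cascade_letter:
  assumes "a \<le> s" "s < n"
  shows "hecke_eq ([a..<Suc n] @ [s]) (Suc s # [a..<Suc n])"
proof -
  have split: "[a..<Suc n] = [a..<s] @ [s, Suc s] @ [Suc (Suc s)..<Suc n]"
    using assms by (metis Suc_leI append_Cons append_Nil le_SucI le_add_diff_inverse
        less_or_eq_imp_le not_less_eq upt_add_eq_append upt_conv_Cons)
  have "hecke_eq ([a..<Suc n] @ [s]) ([a..<s] @ [s, Suc s] @ (s # [Suc (Suc s)..<Suc n]))"
    unfolding split append_assoc
    by (intro hecke_eq_prefix hecke_eq_commute_letter) auto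
  also have "\<dots> = [a..<s] @ [s, Suc s, s] @ [Suc (Suc s)..<Suc n]" by simp
  also have "hecke_eq \<dots> ([a..<s] @ [Suc s, s, Suc s] @ [Suc (Suc s)..<Suc n])"
    by (intro hecke_eq.congr hecke_eq.braid)
  also have "\<dots> = ([a..<s] @ [Suc s]) @ [s, Suc s] @ [Suc (Suc s)..<Suc n]" by simp
  also have "hecke_eq \<dots> ((Suc s # [a..<s]) @ [s, Suc s] @ [Suc (Suc s)..<Suc n])"
    by (intro hecke_eq_suffix hecke_eq_commute_letter) auto
  also have "\<dots> = Suc s # [a..<Suc n]" unfolding split by simp
  finally show ?thesis .
qed

lemma hecke_eq_cascade_shift:
  assumes "\<And>s. s \<in> set w \<Longrightarrow> a \<le> s \<and> s < n"
  shows "hecke_eq ([a..<Suc n] @ w) (map Suc w @ [a..<Suc n])"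
  using assms
proof (induction w)
  case Nil
  show ?case by (simp add: hecke_eq.refl)
next
  case (Cons s w)
  have "hecke_eq (([a..<Suc n] @ [s]) @ w) ((Suc s # [a..<Suc n]) @ w)"
    using Cons.prems[of s] by (intro hecke_eq_suffix hecke_eq_cascade_letter) auto
  also have "hecke_eq \<dots> (Suc s # map Suc w @ [a..<Suc n])"
    unfolding append_Cons using Cons by (intro hecke_eq_Cons) simp
  finally show ?case by simp
qed

section \<open>The triangle word and its absorption of letters\<close>

definition triangle_word :: "nat \<Rightarrow> nat \<Rightarrow> nat list" where
  "triangle_word n m = concat (map (\<lambda>k. [Suc n - k..<Suc n]) [1..<Suc m])"

lemma triangle_word_Suc: "triangle_word n (Suc m) = triangle_word n m @ [n - m..<Suc n]"
  by (simp add: triangle_word_def)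

text \<open>The last letter of a cascade is \<open>n\<close>, so \<open>s = n\<close> is absorbed by
  idempotence. Any smaller \<open>s\<close> passes through the last cascade and emerges on its left
  as \<open>Suc s\<close>, which satisfies the lower bound for the triangle with one cascade
  fewer.\<close>

lemma triangle_word_absorbs_letter:
  assumes "m < n" "n - m \<le> s" "s \<le> n"
  shows "hecke_eq (triangle_word n (Suc m) @ [s]) (triangle_word n (Suc m))"
  using assms
proof (induction m arbitrary: s)
  case 0
  then show ?case by (simp add: triangle_word_def hecke_eq.idem)
next
  case (Suc m)
  show ?case
  proof (cases "s = n")
    case True
    have "triangle_word n (Suc (Suc m)) = (triangle_word n (Suc m) @ [n - Suc m..<n]) @ [n]"
      by (subst triangle_word_Suc) simp
    moreover have "hecke_eq (\<dots> @ [n]) \<dots>"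
      unfolding append_assoc by (intro hecke_eq_prefix) (simp add: hecke_eq.idem)
    ultimately show ?thesis using True by simp
  next
    case False
    have "hecke_eq (triangle_word n (Suc m) @ [n - Suc m..<Suc n] @ [s])
        (triangle_word n (Suc m) @ Suc s # [n - Suc m..<Suc n])"
      using Suc.prems False by (intro hecke_eq_prefix hecke_eq_cascade_letter) auto
    also have "\<dots> = (triangle_word n (Suc m) @ [Suc s]) @ [n - Suc m..<Suc n]" by simp
    also have "hecke_eq \<dots> (triangle_word n (Suc m) @ [n - Suc m..<Suc n])"
      using Suc.prems False by (intro hecke_eq_suffix Suc.IH) auto
    finally show ?thesis by (subst (1 2) triangle_word_Suc) simp
  qed
qed

lemma triangle_word_absorbs:
  assumes "set w \<subseteq> {1..n}"
  shows "hecke_eq (triangle_word n n @ w) (triangle_word n n)"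
  using assms
proof (induction w)
  case Nil
  show ?case by (simp add: hecke_eq.refl)
next
  case (Cons s w)
  then obtain m where m: "n = Suc m" by (cases n) auto
  have "hecke_eq ((triangle_word n n @ [s]) @ w) (triangle_word n n @ w)"
    using triangle_word_absorbs_letter[of m n s] Cons.prems m by (intro hecke_eq_suffix) auto
  also have "hecke_eq \<dots> (triangle_word n n)" using Cons by simp
  finally show ?case by simp
qed

text \<open>Commutations alone suffice: an element of a trace monoid is determined by its projections
  to the pairs of non-commuting letters.\<close>

lemma hecke_eq_if_projections_eq:
  assumes "set u \<subseteq> {1..n}" "set v \<subseteq> {1..n}" "n \<ge> 2"
    and "\<And>s. 1 \<le> s \<Longrightarrow> s < n \<Longrightarrow>
      filter (\<lambda>x. x = s \<or> x = Suc s) u = filter (\<lambda>x. x = s \<or> x = Suc s) v"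
  shows "hecke_eq u v"
  using assms
proof (induction u arbitrary: v)
  case Nil
  have "v = []"
  proof (rule ccontr)
    assume "v \<noteq> []"
    then obtain a v' where "v = a # v'" by (cases v) auto
    \<comment> \<open>A letter is visible in the projection to some pair \<open>s, Suc s\<close>
      with \<open>s < n\<close>; the top letter \<open>n\<close> lies only in the pair starting at
      \<open>n - 1\<close>.\<close>
    with Nil show False
      using Nil(4)[of "if a = n then a - 1 else a"] by (cases "a = n") (auto simp: le_diff_conv2)
  qed
  then show ?case by (simp add: hecke_eq.refl)
next
  case (Cons a u)
  let ?f = "\<lambda>s. filter (\<lambda>x. x = s \<or> x = Suc s)"
  have "a \<in> set v"
  proof -
    let ?s = "if a = n then a - 1 else a"
    have "a \<in> set (?f ?s (a # u))" using Cons.prems by auto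
    also have "?f ?s (a # u) = ?f ?s v" using Cons.prems(1,3) by (intro Cons.prems(4)) auto
    finally show ?thesis by auto
  qed
  then obtain p q where v: "v = p @ a # q" and p: "a \<notin> set p"
    by (meson split_list_first)
  \<comment> \<open>A letter of \<open>p\<close> adjacent to \<open>a\<close> would precede the
    first \<open>a\<close> of \<open>v\<close> in their common projection, whereas the projection of
    \<open>a # u\<close> starts with \<open>a\<close>.\<close>
  have far: "Suc a < b \<or> Suc b < a" if b: "b \<in> set p" for b
  proof (rule ccontr)
    assume near: "\<not> ?thesis"
    define s where "s = min a b"
    have ab: "a \<noteq> b" using b p by auto
    have "b \<in> {1..n}" using b Cons.prems(2) v by auto
    with near ab Cons.prems(1) have s: "1 \<le> s" "s < n" "b = s \<or> b = Suc s" "a = s \<or> a = Suc s"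
      by (auto simp: s_def min_def)
    have "?f s (a # u) = ?f s p @ ?f s (a # q)" using Cons.prems(4)[OF s(1,2)] v by simp
    moreover have "b \<in> set (?f s p)" using b s by auto
    moreover have "a \<notin> set (?f s p)" using p by auto
    ultimately show False using s(4) by (cases "?f s p") (auto split: if_splits)
  qed
  have "hecke_eq u (p @ q)"
  proof (rule Cons.IH)
    \<comment> \<open>Deleting this \<open>a\<close> keeps the projections equal: where
      \<open>a\<close> is visible, \<open>p\<close> projects to the empty word by
      \<open>far\<close>, so \<open>a\<close> is the head on both sides.\<close>
    fix s assume s: "1 \<le> s" "s < n"
    have "?f s (a # u) = ?f s (p @ a # q)" using Cons.prems(4)[OF s] v by simp
    moreover have "?f s p = []" if "a = s \<or> a = Suc s"
      using far that p by (fastforce simp: filter_empty_conv)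
    ultimately show "?f s u = ?f s (p @ q)" by (auto split: if_splits)
  qed (use Cons.prems v in auto)
  then have "hecke_eq (a # u) ((a # p) @ q)" by (simp add: hecke_eq_Cons)
  also have "hecke_eq \<dots> ((p @ [a]) @ q)"
    using hecke_eq_commute_letter[OF far] by (intro hecke_eq_suffix hecke_eq.sym[of "p @ [a]"])
  finally show ?case using v by simp
qed

section \<open>The square word and its diagonals\<close>

definition brick_word :: "nat \<Rightarrow> nat list" where
  "brick_word N = concat (replicate N (filter odd [1..<2 * N] @ filter even [1..<2 * N]))"

text \<open>Placing the \<open>t\<close>-th layer of the square circuit at time \<open>t\<close>, slot \<open>s\<close> occurs at the times
  \<open>t\<close> with \<open>s + t\<close> even; the diagonals are the sets of constant \<open>t - s\<close>, each an ascending run of slots.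
  The upper ones reach slot \<open>n\<close>, the lower ones end in the last layer.\<close>

definition upper_diagonals :: "nat \<Rightarrow> nat \<Rightarrow> nat list" where
  "upper_diagonals n m = concat (map (\<lambda>i. [n - 2 * i..<Suc n]) [0..<m])"

definition lower_diagonals :: "nat \<Rightarrow> nat \<Rightarrow> nat \<Rightarrow> nat list" where
  "lower_diagonals n a r = concat (map (\<lambda>i. [a..<n - 2 * i]) [0..<r])"

text \<open>The newest upper diagonal \<open>[a..<Suc n]\<close> is a cascade, so pushing the lower
  diagonals leftwards through it raises their letters by one. The first of them thereby becomes the
  cascade \<open>[Suc a..<Suc n]\<close>; pushing the others through that one raises them again, to
  the lower diagonals of the case \<open>r\<close>. Two cascades, the next two of the triangle, are
  left at the right end.\<close>

lemma diagonals_hecke_eq_triangle_word: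
  assumes "2 * r < n"
  shows "hecke_eq (upper_diagonals n (Suc r) @ lower_diagonals n (n - 2 * r) r) (triangle_word n (2 * r + 1))"
  using assms
proof (induction r)
  case 0
  show ?case by (simp add: upper_diagonals_def lower_diagonals_def triangle_word_def hecke_eq.refl)
next
  case (Suc r)
  define a where "a = n - 2 * Suc r"
  have a: "a \<ge> 1" "Suc (Suc a) = n - 2 * r" "Suc a = n - Suc (2 * r)" using Suc.prems by (auto simp: a_def)
  \<comment> \<open>\<open>Y\<close> consists of the lower diagonals after the first, already raised
    once; a second raise makes them start at \<open>n - 2 * r\<close>.\<close>
  define Y where "Y = concat (map (\<lambda>i. [Suc a..<n - Suc (2 * i)]) [0..<r])"
  have Y: "map Suc Y = lower_diagonals n (Suc (Suc a)) r"
    unfolding Y_def lower_diagonals_def map_concat map_map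
    using Suc.prems
    by (intro arg_cong[where f = concat] map_cong) (auto simp: map_Suc_upt Suc_diff_Suc)
  have "lower_diagonals n a (Suc r) = [a..<n] @ concat (map (\<lambda>i. [a..<n - 2 * Suc i]) [0..<r])"
    unfolding lower_diagonals_def upt_conv_Cons[OF zero_less_Suc]
    by (simp only: list.map concat.simps map_Suc_upt[symmetric] map_map o_def) simp
  then have X: "map Suc (lower_diagonals n a (Suc r)) = [Suc a..<Suc n] @ Y"
    unfolding Y_def using Suc.prems
    by (auto simp: map_concat map_Suc_upt Suc_diff_Suc intro!: arg_cong[where f = concat] map_cong)
  have "upper_diagonals n (Suc (Suc r)) @ lower_diagonals n a (Suc r)
      = upper_diagonals n (Suc r) @ [a..<Suc n] @ lower_diagonals n a (Suc r)"
    by (simp add: upper_diagonals_def a_def)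
  also have "hecke_eq \<dots> (upper_diagonals n (Suc r) @ map Suc (lower_diagonals n a (Suc r)) @ [a..<Suc n])"
    by (intro hecke_eq_prefix hecke_eq_cascade_shift) (auto simp: lower_diagonals_def)
  also have "\<dots> = upper_diagonals n (Suc r) @ ([Suc a..<Suc n] @ Y) @ [a..<Suc n]"
    by (simp add: X)
  also have "hecke_eq \<dots> (upper_diagonals n (Suc r) @ (map Suc Y @ [Suc a..<Suc n]) @ [a..<Suc n])"
    by (intro hecke_eq.congr hecke_eq_cascade_shift) (auto simp: Y_def)
  also have "\<dots> = (upper_diagonals n (Suc r) @ lower_diagonals n (n - 2 * r) r)
      @ [n - Suc (2 * r)..<Suc n] @ [n - Suc (Suc (2 * r))..<Suc n]"
    using a by (simp add: Y a_def)
  also have "hecke_eq \<dots> (triangle_word n (2 * r + 1) @ [n - Suc (2 * r)..<Suc n] @ [n - Suc (Suc (2 * r))..<Suc n])"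
    using Suc.prems by (intro hecke_eq_suffix Suc.IH) simp
  also have "\<dots> = triangle_word n (2 * Suc r + 1)"
    by (simp add: triangle_word_Suc)
  finally show ?case by (simp add: a_def)
qed

section \<open>Projections of the diagonals to two neighbouring slots\<close>

lemma filter_pair_upt:
  "filter (\<lambda>x. x = s \<or> x = Suc s) [a..<b] =
     (if a \<le> s \<and> s < b then [s] else []) @ (if a \<le> Suc s \<and> Suc s < b then [Suc s] else [])"
  by (induction b) (auto simp: less_Suc_eq)

lemma concat_replicate_Suc: "concat (replicate (Suc k) xs) = concat (replicate k xs) @ xs"
  by (induction k) auto

text \<open>Diagonal \<open>i\<close> contains \<open>s\<close> iff
  \<open>n - s \<le> 2 * i\<close>, and \<open>Suc s\<close> iff
  \<open>n - s \<le> 2 * i + 1\<close>. For even \<open>n - s\<close> both enter at the same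
  \<open>i\<close>; for odd \<open>n - s\<close> the letter \<open>Suc s\<close> enters one diagonal
  earlier, which gives the lone head.\<close>

lemma filter_upper_diagonals:
  assumes "1 \<le> s" "s < n" "2 * m \<le> Suc n"
  shows "filter (\<lambda>x. x = s \<or> x = Suc s) (upper_diagonals n m) =
    (if even (n - s) then concat (replicate (m - (n - s) div 2) [s, Suc s])
     else if m \<le> (n - s) div 2 then []
     else Suc s # concat (replicate (m - Suc ((n - s) div 2)) [s, Suc s]))"
  using assms(3)
proof (induction m)
  case 0
  show ?case by (simp add: upper_diagonals_def)
next
  case (Suc m)
  have d: "upper_diagonals n (Suc m) = upper_diagonals n m @ [n - 2 * m..<Suc n]"
    by (simp add: upper_diagonals_def)
  show ?case
  proof (cases "even (n - s)")
    case True
    then obtain j where j: "n - s = 2 * j" by blast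
    have "Suc m \<le> j \<or> j \<le> m" by linarith
    then show ?thesis
    proof
      assume "Suc m \<le> j"
      with j have "\<not> n - 2 * m \<le> Suc s" by linarith
      with Suc j \<open>Suc m \<le> j\<close> show ?thesis
        unfolding d filter_append filter_pair_upt by simp
    next
      assume "j \<le> m"
      with j assms have "n - 2 * m \<le> s" by linarith
      with Suc j \<open>j \<le> m\<close> assms show ?thesis
        unfolding d filter_append filter_pair_upt
        by (simp add: Suc_diff_le concat_replicate_Suc del: replicate_Suc)
    qed
  next
    case False
    then obtain j where j: "n - s = 2 * j + 1" by (elim oddE)
    consider "Suc m \<le> j" | "m = j" | "Suc j \<le> m" by linarith
    then show ?thesis
    proof cases
      case 1
      with j have "\<not> n - 2 * m \<le> Suc s" by linarith
      with Suc j 1 show ?thesis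
        unfolding d filter_append filter_pair_upt by simp
    next
      case 2
      with j assms have "n - 2 * m = Suc s" by linarith
      with Suc j 2 assms show ?thesis
        unfolding d filter_append filter_pair_upt by simp
    next
      case 3
      with j assms have "n - 2 * m \<le> s" by linarith
      moreover from 3 have "Suc m - Suc j = Suc (m - Suc j)" by linarith
      ultimately show ?thesis using Suc j 3 assms
        unfolding d filter_append filter_pair_upt
        by (simp add: concat_replicate_Suc del: replicate_Suc)
    qed
  qed
qed

text \<open>Dually to the upper diagonals, letters drop out as \<open>i\<close> grows: for even
  \<open>n - s\<close> both at once, for odd \<open>n - s\<close> the letter \<open>s\<close>
  survives one diagonal longer than \<open>Suc s\<close>, which gives the lone tail.\<close>

lemma filter_lower_diagonals:
  assumes "1 \<le> s" "s < n"
  shows "filter (\<lambda>x. x = s \<or> x = Suc s) (lower_diagonals n 1 r) =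
    concat (replicate (min r ((n - s) div 2)) [s, Suc s])
    @ (if odd (n - s) \<and> (n - s) div 2 < r then [s] else [])"
proof (induction r)
  case 0
  show ?case by (simp add: lower_diagonals_def)
next
  case (Suc r)
  have d: "lower_diagonals n 1 (Suc r) = lower_diagonals n 1 r @ [1..<n - 2 * r]"
    by (simp add: lower_diagonals_def)
  define j where "j = (n - s) div 2"
  show ?case
  proof (cases "even (n - s)")
    case True
    then have j': "n - s = 2 * j" by (simp add: j_def)
    have "Suc r \<le> j \<or> j \<le> r" by linarith
    then show ?thesis
    proof
      assume "Suc r \<le> j"
      with j' have "Suc s < n - 2 * r" by linarith
      with Suc True assms \<open>Suc r \<le> j\<close> show ?thesis
        unfolding d filter_append filter_pair_upt j_def[symmetric]
        by (simp add: min_def concat_replicate_Suc del: replicate_Suc)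
    next
      assume "j \<le> r"
      with j' assms have "n - 2 * r \<le> s" by linarith
      with Suc True \<open>j \<le> r\<close> show ?thesis
        unfolding d filter_append filter_pair_upt j_def[symmetric]
        by (simp add: min_def)
    qed
  next
    case False
    then have j': "n - s = 2 * j + 1" unfolding j_def by presburger
    consider "Suc r \<le> j" | "r = j" | "Suc j \<le> r" by linarith
    then show ?thesis
    proof cases
      case 1
      with j' have "Suc s < n - 2 * r" by linarith
      with Suc False assms 1 show ?thesis
        unfolding d filter_append filter_pair_upt j_def[symmetric]
        by (simp add: min_def concat_replicate_Suc del: replicate_Suc)
    next
      case 2
      with j' assms have "n - 2 * r = Suc s" by linarith
      with Suc False 2 assms show ?thesis
        unfolding d filter_append filter_pair_upt j_def[symmetric]
        by (simp add: min_def)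
    next
      case 3
      with j' assms have "n - 2 * r \<le> s" by linarith
      with Suc False 3 show ?thesis
        unfolding d filter_append filter_pair_upt j_def[symmetric]
        by (simp add: min_def)
    qed
  qed
qed

lemma concat_replicate_shift: "a # concat (replicate k [b, a]) @ [b] = concat (replicate (Suc k) [a, b])"
  by (induction k) auto

lemma filter_swap:
  "filter P (filter Q xs) = filter Q (filter P xs)"
  by (simp add: conj_commute)

text \<open>On each pair of neighbouring slots both the layers and the diagonals show
  \<open>N\<close> alternations that begin with the odd slot, so commutations turn one reading into
  the other. For even \<open>s\<close> the lone head from the upper diagonals and the lone tail from
  the lower ones complete the alternation.\<close>

lemma brick_word_hecke_eq_triangle_word:
  assumes "N \<ge> 2"
  shows "hecke_eq (brick_word N) (triangle_word (2 * N - 1) (2 * N - 1))"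
proof -
  define n where "n = 2 * N - 1"
  have n: "2 * N = Suc n" "odd n" "n \<ge> 2" using assms by (auto simp: n_def)
  have "hecke_eq (brick_word N) (upper_diagonals n N @ lower_diagonals n 1 (N - 1))"
  proof (rule hecke_eq_if_projections_eq[of _ n])
    show "set (brick_word N) \<subseteq> {1..n}" by (auto simp: brick_word_def n(1))
    show "set (upper_diagonals n N @ lower_diagonals n 1 (N - 1)) \<subseteq> {1..n}"
      using assms by (auto simp: upper_diagonals_def lower_diagonals_def n_def)
    fix s assume s: "1 \<le> s" "s < n"
    have "filter (\<lambda>x. x = s \<or> x = Suc s) (brick_word N)
        = concat (replicate N (if odd s then [s, Suc s] else [Suc s, s]))"
      unfolding brick_word_def filter_concat map_replicate filter_append
        filter_swap[of _ odd] filter_swap[of _ even] filter_pair_upt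
      using s n by auto
    moreover have "filter (\<lambda>x. x = s \<or> x = Suc s) (upper_diagonals n N @ lower_diagonals n 1 (N - 1))
        = concat (replicate N (if odd s then [s, Suc s] else [Suc s, s]))"
    proof (cases "odd s")
      case True
      with n s have "even (n - s)" by simp
      then obtain j where j: "n - s = 2 * j" by blast
      have "N = (N - j) + j" using j n s by linarith
      then have "concat (replicate N [s, Suc s])
          = concat (replicate (N - j) [s, Suc s]) @ concat (replicate j [s, Suc s])"
        by (metis concat_append replicate_add)
      moreover have "min (N - 1) j = j" using j n s by linarith
      ultimately show ?thesis
        using True s n j filter_upper_diagonals[OF s, of N] filter_lower_diagonals[OF s, of "N - 1"]
        by simp
    next
      case False
      with n s have "odd (n - s)" by simp
      then obtain j where j: "n - s = 2 * j + 1" by (elim oddE)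
      \<comment> \<open>An even \<open>s\<close> is at least 2, hence \<open>j < N - 1\<close>; this
        places diagonal \<open>j\<close>, which carries the lone \<open>s\<close>, among the
        \<open>N - 1\<close> lower ones.\<close>
      have "s \<noteq> 1" using False by auto
      with j n s have jN: "Suc (Suc j) \<le> N" by linarith
      have "N = Suc ((N - Suc j) + j)" using jN by linarith
      then have "concat (replicate N [Suc s, s]) = Suc s # concat (replicate ((N - Suc j) + j) [s, Suc s]) @ [s]"
        by (metis concat_replicate_shift)
      also have "\<dots> = Suc s # concat (replicate (N - Suc j) [s, Suc s]) @ concat (replicate j [s, Suc s]) @ [s]"
        by (simp only: replicate_add concat_append append_assoc)
      finally show ?thesis
        using False s n j jN filter_upper_diagonals[OF s, of N] filter_lower_diagonals[OF s, of "N - 1"]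
        by (simp add: min_def)
    qed
    ultimately show "filter (\<lambda>x. x = s \<or> x = Suc s) (brick_word N) =
      filter (\<lambda>x. x = s \<or> x = Suc s) (upper_diagonals n N @ lower_diagonals n 1 (N - 1))" by simp
  qed (use n in simp)
  also have "hecke_eq \<dots> (triangle_word n n)"
  proof -
    have "2 * (N - 1) < n" "Suc (N - 1) = N" "n - 2 * (N - 1) = 1" "2 * (N - 1) + 1 = n"
      using assms by (auto simp: n_def)
    then show ?thesis using diagonals_hecke_eq_triangle_word[of "N - 1" n] by simp
  qed
  finally show ?thesis by (simp add: n_def)
qed

section \<open>Pauli strings\<close>

lemma sum_div_mod:
  fixes f :: "nat \<Rightarrow> nat \<Rightarrow> 'a :: comm_monoid_add"
  shows "(\<Sum>k<m * n. f (k div n) (k mod n)) = (\<Sum>i<m. \<Sum>j<n. f i j)"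
proof -
  have "(\<Sum>k<m * n. f (k div n) (k mod n)) = (\<Sum>i<m. \<Sum>k = i * n..<i * n + n. f (k div n) (k mod n))"
    by (rule sum.nat_group[symmetric])
  also have "\<dots> = (\<Sum>i<m. \<Sum>j<n. f i j)"
  proof (rule sum.cong[OF HOL.refl])
    fix i
    show "(\<Sum>k = i * n..<i * n + n. f (k div n) (k mod n)) = (\<Sum>j<n. f i j)"
      by (rule sum.reindex_bij_witness[of _ "\<lambda>j. i * n + j" "\<lambda>k. k - i * n"])
        (auto simp: mult.commute[of n] dest!: le_Suc_ex)
  qed
  finally show ?thesis .
qed

lemma kron_carrier:
  "A \<in> carrier_mat m m \<Longrightarrow> B \<in> carrier_mat n n \<Longrightarrow> kron A B \<in> carrier_mat (m * n) (m * n)"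
  by (auto simp: kron_def)

text \<open>The mixed-product rule: the summation index is read as the pair
  \<open>(k div n, k mod n)\<close>, after which the double sum factors.\<close>

lemma kron_mult:
  assumes "A \<in> carrier_mat m m" "C \<in> carrier_mat m m" "B \<in> carrier_mat n n" "D \<in> carrier_mat n n"
  shows "kron A B * kron C D = kron (A * C) (B * D)"
proof (rule eq_matI)
  fix i j assume "i < dim_row (kron (A * C) (B * D))" "j < dim_col (kron (A * C) (B * D))"
  then have ij: "i < m * n" "j < m * n" using assms by (auto simp: kron_def)
  then have n: "n > 0" by (cases n) auto
  have bd: "i div n < m" "i mod n < n" "j div n < m" "j mod n < n"
    using ij n by (auto simp: less_mult_imp_div_less)
  have dv: "k div n < m" if "k < m * n" for k using that by (simp add: less_mult_imp_div_less)
  have "(kron A B * kron C D) $$ (i, j) = (\<Sum>k<m * n.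
     (A $$ (i div n, k div n) * C $$ (k div n, j div n)) * (B $$ (i mod n, k mod n) * D $$ (k mod n, j mod n)))"
    using assms ij by (simp add: kron_def scalar_prod_def lessThan_atLeast0 mult_ac)
  also have "\<dots> = (\<Sum>p<m. \<Sum>q<n. (A $$ (i div n, p) * C $$ (p, j div n)) * (B $$ (i mod n, q) * D $$ (q, j mod n)))"
    by (rule sum_div_mod)
  also have "\<dots> = (\<Sum>p<m. A $$ (i div n, p) * C $$ (p, j div n)) * (\<Sum>q<n. B $$ (i mod n, q) * D $$ (q, j mod n))"
    by (simp add: sum_product)
  also have "\<dots> = kron (A * C) (B * D) $$ (i, j)"
    using assms ij bd by (simp add: kron_def scalar_prod_def lessThan_atLeast0)
  finally show "(kron A B * kron C D) $$ (i, j) = kron (A * C) (B * D) $$ (i, j)" .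
qed (use assms in \<open>auto simp: kron_def\<close>)

lemma kron_smult: "kron (a \<cdot>\<^sub>m A) (b \<cdot>\<^sub>m B) = (a * b) \<cdot>\<^sub>m kron A B"
proof (rule eq_matI)
  fix i j assume ij: "i < dim_row ((a * b) \<cdot>\<^sub>m kron A B)" "j < dim_col ((a * b) \<cdot>\<^sub>m kron A B)"
  then have "i < dim_row A * dim_row B" "j < dim_col A * dim_col B" by (auto simp: kron_def)
  moreover from this have "dim_row B > 0" "dim_col B > 0" by (auto intro!: Nat.gr0I)
  ultimately show "kron (a \<cdot>\<^sub>m A) (b \<cdot>\<^sub>m B) $$ (i, j) = ((a * b) \<cdot>\<^sub>m kron A B) $$ (i, j)"
    by (simp add: kron_def less_mult_imp_div_less mult_ac)
qed (auto simp: kron_def)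

lemma kron_one: "kron (1\<^sub>m m) (1\<^sub>m n) = 1\<^sub>m (m * n)"
proof (rule eq_matI)
  fix i j assume ij: "i < dim_row (1\<^sub>m (m * n))" "j < dim_col (1\<^sub>m (m * n))"
  then have "n > 0" by (cases n) auto
  moreover have "i = j \<longleftrightarrow> i div n = j div n \<and> i mod n = j mod n" by (metis div_mult_mod_eq)
  ultimately show "kron (1\<^sub>m m) (1\<^sub>m n) $$ (i, j) = 1\<^sub>m (m * n) $$ (i, j)"
    using ij by (auto simp: kron_def less_mult_imp_div_less)
qed (auto simp: kron_def)

lemma tensor_list_simps [simp]:
  "tensor_list [] = 1\<^sub>m 1" "tensor_list (A # As) = kron A (tensor_list As)"
  by (simp_all add: tensor_list_def)

lemma tensor_list_carrier:
  assumes "\<And>j. j \<in> set js \<Longrightarrow> f j \<in> carrier_mat 2 2"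
  shows "tensor_list (map f js) \<in> carrier_mat (2 ^ length js) (2 ^ length js)"
  using assms by (induction js) (auto intro!: kron_carrier)

text \<open>Both factors are written as maps over one common list of sites, so that algebra on the
  full space reduces to 2 by 2 matrices at each site.\<close>

lemma tensor_list_mult:
  assumes "\<And>j. j \<in> set js \<Longrightarrow> f j \<in> carrier_mat 2 2" "\<And>j. j \<in> set js \<Longrightarrow> g j \<in> carrier_mat 2 2"
  shows "tensor_list (map f js) * tensor_list (map g js) = tensor_list (map (\<lambda>j. f j * g j) js)"
  using assms
proof (induction js)
  case (Cons j js)
  then show ?case
    using kron_mult[of "f j" 2 "g j" "tensor_list (map f js)" "2 ^ length js" "tensor_list (map g js)"]
      tensor_list_carrier[of js f] tensor_list_carrier[of js g]
    by simp
qed simp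

lemma tensor_list_smult:
  "tensor_list (map (\<lambda>j. c j \<cdot>\<^sub>m f j) js) = prod_list (map c js) \<cdot>\<^sub>m tensor_list (map f js)"
proof (induction js)
  case Nil
  show ?case by (auto intro!: eq_matI)
qed (simp add: kron_smult)

lemma tensor_list_one: "tensor_list (map (\<lambda>j. 1\<^sub>m 2) js) = 1\<^sub>m (2 ^ length js)"
  by (induction js) (simp_all add: kron_one)

lemma pauli_mat_carrier [simp]: "pauli_mat a \<in> carrier_mat 2 2"
  by (cases a) (simp_all add: mat_of_rows_list_def numeral_2_eq_2)

lemma pauli_mat_square: "pauli_mat a * pauli_mat a = 1\<^sub>m 2"
  by (cases a; rule eq_matI)
    (auto simp: mat_of_rows_list_def scalar_prod_def less_2_cases_iff numeral_2_eq_2 less_Suc_eq)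

lemma pauli_mat_anticommute:
  "a \<noteq> b \<Longrightarrow> pauli_mat a * pauli_mat b = (- 1) \<cdot>\<^sub>m (pauli_mat b * pauli_mat a)"
  by (cases a; cases b; rule eq_matI)
    (auto simp: mat_of_rows_list_def scalar_prod_def less_2_cases_iff numeral_2_eq_2 less_Suc_eq)

section \<open>Pauli strings of the slots\<close>

text \<open>The cases say, without truncated subtraction, that \<open>s\<close> is the odd slot of
  spin \<open>j\<close>, or an even slot whose pair has \<open>j\<close> as its left or its right
  spin.\<close>

definition slot_site :: "pauli \<Rightarrow> pauli \<Rightarrow> nat \<Rightarrow> nat \<Rightarrow> complex mat" where
  "slot_site \<alpha> \<beta> s j =
     (if s + 1 = 2 * j then pauli_mat \<beta>
      else if s = 2 * j \<or> s + 2 = 2 * j then pauli_mat \<alpha> else 1\<^sub>m 2)"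

definition slot_string :: "nat \<Rightarrow> pauli \<Rightarrow> pauli \<Rightarrow> nat \<Rightarrow> complex mat" where
  "slot_string N \<alpha> \<beta> s = tensor_list (map (slot_site \<alpha> \<beta> s) [1..<Suc N])"

lemma slot_site_carrier [simp]: "slot_site \<alpha> \<beta> s j \<in> carrier_mat 2 2"
  by (simp add: slot_site_def)

lemma slot_string_carrier: "slot_string N \<alpha> \<beta> s \<in> carrier_mat (2 ^ N) (2 ^ N)"
  using tensor_list_carrier[of "[1..<Suc N]" "slot_site \<alpha> \<beta> s"] by (simp add: slot_string_def del: upt_Suc)

lemma slot_string_mult:
  "slot_string N \<alpha> \<beta> s * slot_string N \<alpha> \<beta> t =
     tensor_list (map (\<lambda>j. slot_site \<alpha> \<beta> s j * slot_site \<alpha> \<beta> t j) [1..<Suc N])"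
  unfolding slot_string_def by (rule tensor_list_mult) simp_all

lemma slot_string_square: "slot_string N \<alpha> \<beta> s * slot_string N \<alpha> \<beta> s = 1\<^sub>m (2 ^ N)"
proof -
  have "slot_site \<alpha> \<beta> s j * slot_site \<alpha> \<beta> s j = 1\<^sub>m 2" for j
    by (simp add: slot_site_def pauli_mat_square)
  then show ?thesis using tensor_list_one[of "[1..<Suc N]"] by (simp add: slot_string_mult del: upt_Suc)
qed

lemma prod_list_single_sign:
  assumes "distinct js" "i \<in> set js"
  shows "prod_list (map (\<lambda>j. if j = i then - 1 else 1) js) = (- 1 :: complex)"
  using assms by (simp add: prod.distinct_set_conv_list[symmetric] prod.delta)

text \<open>Strings at distance at least two share a spin only if both slots are even, and there
  both carry \<alpha>.\<close>

lemma slot_string_commute: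
  assumes "Suc s < t"
  shows "slot_string N \<alpha> \<beta> s * slot_string N \<alpha> \<beta> t = slot_string N \<alpha> \<beta> t * slot_string N \<alpha> \<beta> s"
proof -
  have "slot_site \<alpha> \<beta> s j * slot_site \<alpha> \<beta> t j = slot_site \<alpha> \<beta> t j * slot_site \<alpha> \<beta> s j" for j
    using assms
    by (auto simp: slot_site_def left_mult_one_mat[OF pauli_mat_carrier] right_mult_one_mat[OF pauli_mat_carrier])
  then show ?thesis by (simp add: slot_string_mult)
qed

text \<open>Neighbouring strings clash, \<alpha> against \<beta>, at exactly one spin, so exactly
  one site contributes a factor -1.\<close>

lemma slot_string_anticommute:
  assumes "\<alpha> \<noteq> \<beta>" "1 \<le> s" "s < 2 * N"
  shows "slot_string N \<alpha> \<beta> s * slot_string N \<alpha> \<beta> (Suc s) =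
    (- 1) \<cdot>\<^sub>m (slot_string N \<alpha> \<beta> (Suc s) * slot_string N \<alpha> \<beta> s)"
proof -
  \<comment> \<open>The clash is at the spin of whichever of the two slots is odd, for either parity
    of \<open>s\<close>.\<close>
  define i where "i = s div 2 + 1"
  have i: "i \<in> set [1..<Suc N]" using assms by (auto simp: i_def)
  have one: "(1 :: complex) \<cdot>\<^sub>m A = A" for A by (rule eq_matI) auto
  have "slot_site \<alpha> \<beta> s j * slot_site \<alpha> \<beta> (Suc s) j
      = (if j = i then - 1 else 1) \<cdot>\<^sub>m (slot_site \<alpha> \<beta> (Suc s) j * slot_site \<alpha> \<beta> s j)" for j
  proof (cases "j = i")
    case True
    have "s + 1 = 2 * i \<or> s + 2 = 2 * i" unfolding i_def by presburger
    then consider "s + 1 = 2 * i" | "s + 2 = 2 * i" by blast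
    then show ?thesis
    proof cases
      case 1
      with True assms(1) show ?thesis
        by (simp add: slot_site_def pauli_mat_anticommute[of \<beta> \<alpha>])
    next
      case 2
      with True assms(1) show ?thesis
        by (simp add: slot_site_def pauli_mat_anticommute[of \<alpha> \<beta>])
    qed
  next
    case False
    then have "s + 1 \<noteq> 2 * j" "s + 2 \<noteq> 2 * j" unfolding i_def by auto
    with False show ?thesis
      by (auto simp: slot_site_def one left_mult_one_mat[OF pauli_mat_carrier] right_mult_one_mat[OF pauli_mat_carrier])
  qed
  then have "slot_string N \<alpha> \<beta> s * slot_string N \<alpha> \<beta> (Suc s) = tensor_list (map (\<lambda>j.
      (if j = i then - 1 else 1) \<cdot>\<^sub>m (slot_site \<alpha> \<beta> (Suc s) j * slot_site \<alpha> \<beta> s j)) [1..<Suc N])"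
    by (simp add: slot_string_mult)
  then show ?thesis
    unfolding tensor_list_smult slot_string_mult
    using prod_list_single_sign[OF _ i] by simp
qed

lemma sigma_eq_tensor_list:
  assumes "1 \<le> i" "i \<le> N"
  shows "sigma N a i = tensor_list (map (\<lambda>j. if j = i then pauli_mat a else 1\<^sub>m 2) [1..<Suc N])"
proof -
  have "[1..<Suc N] = [1..<i] @ [i] @ [Suc i..<Suc N]"
    using assms by (metis append_Cons append_Nil le_SucI le_add_diff_inverse le_imp_less_Suc upt_add_eq_append upt_conv_Cons)
  moreover have "map (\<lambda>j. if j = i then pauli_mat a else 1\<^sub>m 2) [1..<i] = replicate (i - 1) (1\<^sub>m 2)"
    by (rule replicate_eqI) auto
  moreover have "map (\<lambda>j. if j = i then pauli_mat a else 1\<^sub>m 2) [Suc i..<Suc N] = replicate (N - i) (1\<^sub>m 2)"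
    by (rule replicate_eqI) auto
  ultimately show ?thesis by (simp add: sigma_def del: upt_Suc)
qed

lemma slot_string_odd:
  assumes "1 \<le> i" "i \<le> N"
  shows "slot_string N \<alpha> \<beta> (2 * i - 1) = sigma N \<beta> i"
proof -
  have "slot_site \<alpha> \<beta> (2 * i - 1) = (\<lambda>j. if j = i then pauli_mat \<beta> else 1\<^sub>m 2)"
    using assms by (intro ext) (simp add: slot_site_def, presburger)
  then show ?thesis using assms by (simp add: slot_string_def sigma_eq_tensor_list)
qed

lemma slot_string_even:
  assumes "1 \<le> i" "i < N"
  shows "slot_string N \<alpha> \<beta> (2 * i) = sigma N \<alpha> i * sigma N \<alpha> (i + 1)"
proof -
  have "slot_site \<alpha> \<beta> (2 * i) j =
      (if j = i then pauli_mat \<alpha> else 1\<^sub>m 2) * (if j = i + 1 then pauli_mat \<alpha> else 1\<^sub>m 2)" for j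
    by (auto simp: slot_site_def left_mult_one_mat[OF pauli_mat_carrier] right_mult_one_mat[OF pauli_mat_carrier])
  then have "slot_site \<alpha> \<beta> (2 * i) = (\<lambda>j.
      (if j = i then pauli_mat \<alpha> else 1\<^sub>m 2) * (if j = i + 1 then pauli_mat \<alpha> else 1\<^sub>m 2))"
    by (intro ext)
  then show ?thesis using assms
    by (subst (1 2) sigma_eq_tensor_list) (simp_all add: slot_string_def tensor_list_mult del: upt_Suc)
qed

section \<open>Rotations\<close>

text \<open>For an involution \<open>P\<close> this is exp(-i \<phi> P), with \<phi> half the gate
  angle. In this closed form, identities of rotations become comparisons of finitely many
  coefficients.\<close>

definition rot :: "nat \<Rightarrow> complex mat \<Rightarrow> real \<Rightarrow> complex mat" where
  "rot d P \<phi> = complex_of_real (cos \<phi>) \<cdot>\<^sub>m 1\<^sub>m d + (- \<i> * complex_of_real (sin \<phi>)) \<cdot>\<^sub>m P"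

lemma rot_carrier: "P \<in> carrier_mat d d \<Longrightarrow> rot d P \<phi> \<in> carrier_mat d d"
  by (simp add: rot_def)

lemma smult_smult_mat: "a \<cdot>\<^sub>m (b \<cdot>\<^sub>m A) = (a * b :: complex) \<cdot>\<^sub>m A"
  by (rule eq_matI) auto

lemma pow_mat_smult_involution:
  fixes P :: "complex mat"
  assumes "P \<in> carrier_mat d d" "P * P = 1\<^sub>m d"
  shows "(c \<cdot>\<^sub>m P) ^\<^sub>m k = c ^ k \<cdot>\<^sub>m (if even k then 1\<^sub>m d else P)"
proof (induction k)
  case 0
  show ?case using assms by (auto intro!: eq_matI)
next
  case (Suc k)
  have "(c \<cdot>\<^sub>m P) ^\<^sub>m Suc k = (c ^ k \<cdot>\<^sub>m (if even k then 1\<^sub>m d else P)) * (c \<cdot>\<^sub>m P)"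
    by (simp add: Suc)
  also have "\<dots> = (c ^ k * c) \<cdot>\<^sub>m ((if even k then 1\<^sub>m d else P) * P)"
    using assms mult_smult_assoc_mat[of "if even k then 1\<^sub>m d else P" d d "c \<cdot>\<^sub>m P" d "c ^ k"]
      mult_smult_distrib[of "if even k then 1\<^sub>m d else P" d d P d c]
    by (auto simp: smult_smult_mat)
  also have "(if even k then 1\<^sub>m d else P) * P = (if even (Suc k) then 1\<^sub>m d else P)"
    using assms by simp
  finally show ?case by (simp add: mult.commute)
qed

text \<open>The coefficient \<open>a\<close> at even and \<open>b\<close> at odd \<open>k\<close>
  equals (a + b) / 2 plus (-1)^k (a - b) / 2, so the series is a combination of the exponential
  series at \<open>c\<close> and \<open>- c\<close>.\<close>

lemma exp_parity_split_sums:
  fixes a b c :: complex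
  shows "(\<lambda>k. c ^ k * (if even k then a else b) / fact k) sums
    (exp c * ((a + b) / 2) + exp (- c) * ((a - b) / 2))"
proof -
  have e: "(\<lambda>k. z ^ k / fact k) sums exp z" for z :: complex
    using exp_converges[of z] by (simp add: scaleR_conv_of_real divide_inverse mult.commute)
  have "(\<lambda>k. c ^ k / fact k * ((a + b) / 2) + (- c) ^ k / fact k * ((a - b) / 2)) sums
    (exp c * ((a + b) / 2) + exp (- c) * ((a - b) / 2))"
    by (intro sums_add sums_mult2 e)
  moreover have "c ^ k / fact k * ((a + b) / 2) + (- c) ^ k / fact k * ((a - b) / 2)
      = c ^ k * (if even k then a else b) / fact k" for k
    by (auto simp: field_simps)
  ultimately show ?thesis by simp
qed

text \<open>Powers of a multiple of \<open>P\<close> alternate between multiples of the identity and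
  of \<open>P\<close>, so every matrix entry is a parity-split exponential series.\<close>

lemma mat_exp_involution:
  assumes "P \<in> carrier_mat d d" "P * P = 1\<^sub>m d"
  shows "mat_exp ((- \<i> * complex_of_real \<theta> / 2) \<cdot>\<^sub>m P) = rot d P (\<theta> / 2)"
proof (rule eq_matI)
  fix i j assume "i < dim_row (rot d P (\<theta> / 2))" "j < dim_col (rot d P (\<theta> / 2))"
  then have ij: "i < d" "j < d" using assms by (auto simp: rot_def)
  define c where "c = - \<i> * complex_of_real \<theta> / 2"
  define x where "x = \<theta> / 2"
  have ex: "exp c = complex_of_real (cos x) - \<i> * complex_of_real (sin x)"
    "exp (- c) = complex_of_real (cos x) + \<i> * complex_of_real (sin x)"
    using cis_conv_exp[of x] cis_conv_exp[of "- x"]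
    by (simp_all add: c_def x_def cis.code complex_eq_iff)
  have "mat_exp (c \<cdot>\<^sub>m P) $$ (i, j) =
      (\<Sum>k. c ^ k * (if even k then 1\<^sub>m d $$ (i, j) else P $$ (i, j)) / fact k)"
    using assms ij by (auto simp: mat_exp_def pow_mat_smult_involution intro!: suminf_cong)
  also have "\<dots> = exp c * ((1\<^sub>m d $$ (i, j) + P $$ (i, j)) / 2) + exp (- c) * ((1\<^sub>m d $$ (i, j) - P $$ (i, j)) / 2)"
    by (rule sums_unique[symmetric, OF exp_parity_split_sums])
  also have "\<dots> = rot d P x $$ (i, j)"
    using assms(1) ij unfolding ex by (simp add: rot_def field_simps)
  finally show "mat_exp ((- \<i> * complex_of_real \<theta> / 2) \<cdot>\<^sub>m P) $$ (i, j) = rot d P (\<theta> / 2) $$ (i, j)"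
    by (simp add: c_def x_def)
qed (use assms in \<open>auto simp: mat_exp_def rot_def\<close>)

lemma mult_rot:
  assumes "A \<in> carrier_mat d d" "P \<in> carrier_mat d d"
  shows "A * rot d P \<phi> = complex_of_real (cos \<phi>) \<cdot>\<^sub>m A + (- \<i> * complex_of_real (sin \<phi>)) \<cdot>\<^sub>m (A * P)"
  using assms unfolding rot_def
  by (subst mult_add_distrib_mat[of _ d d _ d]) (auto simp: mult_smult_distrib[of _ d d _ d])

lemma rot_mult:
  assumes "A \<in> carrier_mat d d" "P \<in> carrier_mat d d"
  shows "rot d P \<phi> * A = complex_of_real (cos \<phi>) \<cdot>\<^sub>m A + (- \<i> * complex_of_real (sin \<phi>)) \<cdot>\<^sub>m (P * A)"
  using assms unfolding rot_def
  by (subst add_mult_distrib_mat[of _ d d _ _ d]) (auto simp: mult_smult_assoc_mat[of _ d d _ d])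

lemma rot_add:
  assumes P: "P \<in> carrier_mat d d" "P * P = 1\<^sub>m d"
  shows "rot d P a * rot d P b = rot d P (a + b)"
proof -
  have "rot d P a * P = complex_of_real (cos a) \<cdot>\<^sub>m P + (- \<i> * complex_of_real (sin a)) \<cdot>\<^sub>m 1\<^sub>m d"
    using rot_mult[OF P(1) P(1)] P(2) by simp
  then show ?thesis
    unfolding mult_rot[OF rot_carrier[OF P(1)] P(1)]
    using P(1) by (auto intro!: eq_matI simp: rot_def cos_add sin_add algebra_simps)
qed

lemma rot_commute:
  assumes "P \<in> carrier_mat d d" "Q \<in> carrier_mat d d" "P * Q = Q * P"
  shows "rot d P a * rot d Q b = rot d Q b * rot d P a"
proof -
  have "rot d P a * Q = Q * rot d P a"
    using assms by (simp add: rot_mult mult_rot)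
  then show ?thesis
    using assms by (simp add: mult_rot[of _ d Q] rot_mult[of _ d Q] rot_carrier)
qed

section \<open>Euler angles and the turnover of three rotations\<close>

text \<open>Euler angles of a unit quaternion: take polar coordinates in the planes of
  \<open>(w, x)\<close> and \<open>(y, z)\<close>. The radii are the cosine and sine of one angle
  \<open>b\<close>, and the two polar angles are a + c and a - c.\<close>

lemma euler_coordinates_ex:
  fixes w x y z :: real
  assumes "w\<^sup>2 + x\<^sup>2 + y\<^sup>2 + z\<^sup>2 = 1"
  shows "\<exists>a b c. w = cos b * cos (a + c) \<and> x = cos b * sin (a + c) \<and>
    y = sin b * cos (a - c) \<and> z = sin b * sin (a - c)"
proof -
  obtain r u where ru: "w = r * cos u" "x = r * sin u" using polar_Ex by blast
  obtain q v where qv: "y = q * cos v" "z = q * sin v" using polar_Ex by blast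
  have "r\<^sup>2 * ((cos u)\<^sup>2 + (sin u)\<^sup>2) + q\<^sup>2 * ((cos v)\<^sup>2 + (sin v)\<^sup>2) = 1"
    using assms ru qv by (simp add: power_mult_distrib algebra_simps del: sin_cos_squared_add sin_cos_squared_add2)
  then have "r\<^sup>2 + q\<^sup>2 = 1" by simp
  then obtain b where "r = cos b" "q = sin b" using sincos_total_2pi by metis
  with ru qv show ?thesis
    by (intro exI[of _ "(u + v) / 2"] exI[of _ b] exI[of _ "(u - v) / 2"]) (simp add: field_simps)
qed

text \<open>Moving \<open>Q\<close> past a rotation about \<open>P\<close> reverses the angle,
  because \<open>Q\<close> anticommutes with \<open>P\<close>. The outer rotations therefore merge
  to angle a + c in the part without \<open>Q\<close>, and to a - c in the part with
  \<open>Q\<close>.\<close>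

lemma rot_triple_expansion:
  assumes P: "P \<in> carrier_mat d d" "P * P = 1\<^sub>m d" and Q: "Q \<in> carrier_mat d d"
    and PQ: "P * Q = (- 1) \<cdot>\<^sub>m (Q * P)"
  shows "rot d P a * rot d Q b * rot d P c =
    complex_of_real (cos b * cos (a + c)) \<cdot>\<^sub>m 1\<^sub>m d
    + (- \<i> * complex_of_real (cos b * sin (a + c))) \<cdot>\<^sub>m P
    + ((- \<i> * complex_of_real (sin b * cos (a - c))) \<cdot>\<^sub>m Q
    + (- complex_of_real (sin b * sin (a - c))) \<cdot>\<^sub>m (P * Q))"
proof -
  have QP: "Q * P = (- 1) \<cdot>\<^sub>m (P * Q)" unfolding PQ using P Q by (auto intro!: eq_matI)
  have flip: "Q * rot d P c = rot d P (- c) * Q"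
    using P Q by (auto intro!: eq_matI simp: mult_rot rot_mult QP)
  note R = rot_carrier[OF P(1)]
  have "rot d P a * rot d Q b * rot d P c = rot d P a * (rot d Q b * rot d P c)"
    using P Q by (intro assoc_mult_mat[of _ d d _ d _ d] rot_carrier)
  also have "rot d Q b * rot d P c =
      complex_of_real (cos b) \<cdot>\<^sub>m rot d P c + (- \<i> * complex_of_real (sin b)) \<cdot>\<^sub>m (rot d P (- c) * Q)"
    using Q by (simp add: rot_mult[OF R] flip)
  also have "rot d P a * \<dots> = complex_of_real (cos b) \<cdot>\<^sub>m (rot d P a * rot d P c)
      + (- \<i> * complex_of_real (sin b)) \<cdot>\<^sub>m (rot d P a * (rot d P (- c) * Q))"
    using R mult_carrier_mat[OF R Q]
    by (subst mult_add_distrib_mat[of _ d d _ d]) (auto simp: mult_smult_distrib[of _ d d _ d])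
  also have "rot d P a * (rot d P (- c) * Q) = rot d P a * rot d P (- c) * Q"
    using R Q by (intro assoc_mult_mat[of _ d d _ d _ d, symmetric])
  also have "\<dots> = complex_of_real (cos (a - c)) \<cdot>\<^sub>m Q + (- \<i> * complex_of_real (sin (a - c))) \<cdot>\<^sub>m (P * Q)"
    using P by (simp add: rot_add rot_mult[OF Q])
  finally have *: "rot d P a * rot d Q b * rot d P c = complex_of_real (cos b) \<cdot>\<^sub>m rot d P (a + c)
      + (- \<i> * complex_of_real (sin b)) \<cdot>\<^sub>m
        (complex_of_real (cos (a - c)) \<cdot>\<^sub>m Q + (- \<i> * complex_of_real (sin (a - c))) \<cdot>\<^sub>m (P * Q))"
    using P by (simp only: rot_add)
  define R where "R = P * Q"
  have "R \<in> carrier_mat d d" using P Q by (simp add: R_def)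
  with P(1) Q show ?thesis
    unfolding * R_def[symmetric] by (auto intro!: eq_matI simp: rot_def algebra_simps)
qed

text \<open>Exchanging \<open>P\<close> and \<open>Q\<close> interchanges their coefficients and
  flips the sign of that of \<open>P * Q\<close>. The permuted quadruple still has norm one, so it
  has Euler coordinates of its own.\<close>

lemma rot_turnover:
  assumes P: "P \<in> carrier_mat d d" "P * P = 1\<^sub>m d" and Q: "Q \<in> carrier_mat d d" "Q * Q = 1\<^sub>m d"
    and PQ: "P * Q = (- 1) \<cdot>\<^sub>m (Q * P)"
  shows "\<exists>a' b' c'. rot d P a * rot d Q b * rot d P c = rot d Q a' * rot d P b' * rot d Q c'"
proof -
  have QP: "Q * P = (- 1) \<cdot>\<^sub>m (P * Q)" unfolding PQ using P Q by (auto intro!: eq_matI)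
  define u v where "u = a + c" and "v = a - c"
  have "(cos b * cos u)\<^sup>2 + (sin b * cos v)\<^sup>2 + (cos b * sin u)\<^sup>2 + (- (sin b * sin v))\<^sup>2
      = (cos b)\<^sup>2 * ((cos u)\<^sup>2 + (sin u)\<^sup>2) + (sin b)\<^sup>2 * ((cos v)\<^sup>2 + (sin v)\<^sup>2)"
    by (simp add: power_mult_distrib algebra_simps del: sin_cos_squared_add sin_cos_squared_add2)
  then obtain a' b' c' where e: "cos b * cos u = cos b' * cos (a' + c')"
      "sin b * cos v = cos b' * sin (a' + c')" "cos b * sin u = sin b' * cos (a' - c')"
      "- (sin b * sin v) = sin b' * sin (a' - c')"
    using euler_coordinates_ex[of "cos b * cos u" "sin b * cos v" "cos b * sin u" "- (sin b * sin v)"]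
    by auto
  define R where "R = P * Q"
  have R: "R \<in> carrier_mat d d" using P Q by (simp add: R_def)
  have "rot d P a * rot d Q b * rot d P c = rot d Q a' * rot d P b' * rot d Q c'"
    unfolding rot_triple_expansion[OF P Q(1) PQ] rot_triple_expansion[OF Q P(1) QP]
      e[symmetric] u_def[symmetric] v_def[symmetric]
    unfolding QP R_def[symmetric]
    using P(1) Q(1) R by (auto intro!: eq_matI simp flip: of_real_minus)
  then show ?thesis by blast
qed

section \<open>Operators realised by a word of slots\<close>

lemma mat_prod_simps [simp]: "mat_prod d [] = 1\<^sub>m d" "mat_prod d (A # As) = A * mat_prod d As"
  by (simp_all add: mat_prod_def)

lemma mat_prod_carrier: "set As \<subseteq> carrier_mat d d \<Longrightarrow> mat_prod d As \<in> carrier_mat d d"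
  by (induction As) auto

lemma mat_prod_append:
  "set As \<subseteq> carrier_mat d d \<Longrightarrow> set Bs \<subseteq> carrier_mat d d \<Longrightarrow>
    mat_prod d (As @ Bs) = mat_prod d As * mat_prod d Bs"
proof (induction As)
  case Nil
  then show ?case using mat_prod_carrier[of Bs d] by simp
next
  case (Cons A As)
  then show ?case
    using assoc_mult_mat[of A d d "mat_prod d As" d "mat_prod d Bs" d] mat_prod_carrier[of As d]
      mat_prod_carrier[of Bs d]
    by simp
qed

lemma gate_in_slot_iff:
  "gate_in_slot N \<alpha> \<beta> s g \<longleftrightarrow> s \<in> {1..<2 * N} \<and>
     (\<exists>\<theta>. g = (if odd s then Rot1 \<beta> ((s + 1) div 2) \<theta> else Rot2 \<alpha> (s div 2) \<theta>))"
  (is "_ \<longleftrightarrow> ?R")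
proof
  show "gate_in_slot N \<alpha> \<beta> s g \<Longrightarrow> ?R"
    unfolding gate_in_slot_def by (elim disjE bexE exE conjE) auto
  assume ?R
  then obtain \<theta> where s: "1 \<le> s" "s < 2 * N"
    and g: "g = (if odd s then Rot1 \<beta> ((s + 1) div 2) \<theta> else Rot2 \<alpha> (s div 2) \<theta>)" by auto
  show "gate_in_slot N \<alpha> \<beta> s g"
  proof (cases "odd s")
    case True
    then obtain k where "s = 2 * k + 1" by (elim oddE)
    then show ?thesis using s g unfolding gate_in_slot_def
      by (intro disjI1 bexI[of _ "k + 1"] exI[of _ \<theta>]) auto
  next
    case False
    then obtain k where "s = 2 * k" by blast
    then show ?thesis using s g unfolding gate_in_slot_def
      by (intro disjI2 bexI[of _ k] exI[of _ \<theta>]) auto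
  qed
qed

lemma gate_op_slot:
  assumes "s \<in> {1..<2 * N}"
  shows "gate_op N (if odd s then Rot1 \<beta> ((s + 1) div 2) \<theta> else Rot2 \<alpha> (s div 2) \<theta>) =
    rot (2 ^ N) (slot_string N \<alpha> \<beta> s) (\<theta> / 2)"
proof (cases "odd s")
  case True
  then obtain k where "s = 2 * k + 1" by (elim oddE)
  then show ?thesis using assms slot_string_odd[of "k + 1" N \<alpha> \<beta>]
      mat_exp_involution[OF slot_string_carrier[of N \<alpha> \<beta> s] slot_string_square, of \<theta>] by simp
next
  case False
  then obtain k where "s = 2 * k" by blast
  then show ?thesis using assms slot_string_even[of k N \<alpha> \<beta>]
      mat_exp_involution[OF slot_string_carrier[of N \<alpha> \<beta> s] slot_string_square, of \<theta>] by simp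
qed

text \<open>All angles are quantified away. The set is empty as soon as \<open>w\<close> contains a
  number that is not a slot.\<close>

definition word_ops :: "nat \<Rightarrow> pauli \<Rightarrow> pauli \<Rightarrow> nat list \<Rightarrow> complex mat set" where
  "word_ops N \<alpha> \<beta> w = circuit_op N ` {c. list_all2 (gate_in_slot N \<alpha> \<beta>) w c}"

lemma word_ops_singleton:
  "word_ops N \<alpha> \<beta> [s] =
    (if s \<in> {1..<2 * N} then range (rot (2 ^ N) (slot_string N \<alpha> \<beta> s)) else {})"
proof (cases "s \<in> {1..<2 * N}")
  case True
  let ?g = "\<lambda>\<theta>. if odd s then Rot1 \<beta> ((s + 1) div 2) \<theta> else Rot2 \<alpha> (s div 2) \<theta>"
  have "{c. list_all2 (gate_in_slot N \<alpha> \<beta>) [s] c} = range (\<lambda>\<theta>. [?g \<theta>])"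
    using True by (auto simp: list_all2_Cons1 gate_in_slot_iff)
  then have "word_ops N \<alpha> \<beta> [s] = range (\<lambda>\<theta>. rot (2 ^ N) (slot_string N \<alpha> \<beta> s) (\<theta> / 2))"
    unfolding word_ops_def
    using gate_op_slot[OF True, of \<beta> _ \<alpha>] rot_carrier[OF slot_string_carrier, of N \<alpha> \<beta> s]
    by (simp add: image_image circuit_op_def right_mult_one_mat[of _ "2 ^ N" "2 ^ N"])
  \<comment> \<open>The half in the gate angle disappears, since halving maps onto all
    reals.\<close>
  also have "\<dots> = range (rot (2 ^ N) (slot_string N \<alpha> \<beta> s))"
  proof -
    have "range (\<lambda>\<theta> :: real. \<theta> / 2) = UNIV" by (rule surjI[of _ "\<lambda>x. 2 * x"]) simp
    then show ?thesis by (metis image_image)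
  qed
  finally show ?thesis using True by simp
next
  case False
  then have "{c. list_all2 (gate_in_slot N \<alpha> \<beta>) [s] c} = {}"
    by (auto simp: list_all2_Cons1 gate_in_slot_iff)
  then show ?thesis using False by (simp only: word_ops_def) simp
qed

lemma gate_ops_carrier:
  assumes "list_all2 (gate_in_slot N \<alpha> \<beta>) w c"
  shows "gate_op N ` set c \<subseteq> carrier_mat (2 ^ N) (2 ^ N)"
proof
  fix A assume "A \<in> gate_op N ` set c"
  then obtain s g where "gate_in_slot N \<alpha> \<beta> s g" "A = gate_op N g"
    using assms by (metis (no_types, lifting) imageE in_set_conv_nth list_all2_conv_all_nth)
  then show "A \<in> carrier_mat (2 ^ N) (2 ^ N)"
    using gate_op_slot[of s N \<beta> _ \<alpha>] rot_carrier[OF slot_string_carrier, of N \<alpha> \<beta> s]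
    by (auto simp: gate_in_slot_iff)
qed

lemma circuit_op_append:
  assumes "list_all2 (gate_in_slot N \<alpha> \<beta>) u c" "list_all2 (gate_in_slot N \<alpha> \<beta>) v d"
  shows "circuit_op N (c @ d) = circuit_op N d * circuit_op N c"
  unfolding circuit_op_def map_append rev_append
  using gate_ops_carrier[OF assms(1)] gate_ops_carrier[OF assms(2)]
  by (intro mat_prod_append) simp_all

lemma word_ops_carrier: "word_ops N \<alpha> \<beta> w \<subseteq> carrier_mat (2 ^ N) (2 ^ N)"
  using gate_ops_carrier[of N \<alpha> \<beta> w]
  by (fastforce simp: word_ops_def circuit_op_def intro!: mat_prod_carrier)

lemma word_ops_Nil: "word_ops N \<alpha> \<beta> [] = {1\<^sub>m (2 ^ N)}"
  by (simp add: word_ops_def circuit_op_def)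

lemma word_ops_append:
  "word_ops N \<alpha> \<beta> (u @ v) = {B * A | A B. A \<in> word_ops N \<alpha> \<beta> u \<and> B \<in> word_ops N \<alpha> \<beta> v}"
proof (intro equalityI subsetI)
  fix X assume "X \<in> word_ops N \<alpha> \<beta> (u @ v)"
  then obtain c d where "list_all2 (gate_in_slot N \<alpha> \<beta>) u c" "list_all2 (gate_in_slot N \<alpha> \<beta>) v d"
    "X = circuit_op N (c @ d)"
    by (auto simp: word_ops_def list_all2_append1)
  then show "X \<in> {B * A | A B. A \<in> word_ops N \<alpha> \<beta> u \<and> B \<in> word_ops N \<alpha> \<beta> v}"
    using circuit_op_append by (auto simp: word_ops_def)
next
  fix X assume "X \<in> {B * A | A B. A \<in> word_ops N \<alpha> \<beta> u \<and> B \<in> word_ops N \<alpha> \<beta> v}"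
  then obtain c d where cd: "list_all2 (gate_in_slot N \<alpha> \<beta>) u c" "list_all2 (gate_in_slot N \<alpha> \<beta>) v d"
    and X: "X = circuit_op N d * circuit_op N c"
    by (auto simp: word_ops_def)
  show "X \<in> word_ops N \<alpha> \<beta> (u @ v)"
    unfolding word_ops_def X circuit_op_append[OF cd, symmetric]
    using cd by (intro imageI) (simp add: list_all2_appendI)
qed

lemma one_mem_word_ops: "set w \<subseteq> {1..<2 * N} \<Longrightarrow> 1\<^sub>m (2 ^ N) \<in> word_ops N \<alpha> \<beta> w"
proof (induction w)
  case Nil
  show ?case by (simp add: word_ops_Nil)
next
  case (Cons s w)
  have "1\<^sub>m (2 ^ N) = rot (2 ^ N) (slot_string N \<alpha> \<beta> s) 0"
    using slot_string_carrier[of N \<alpha> \<beta> s] by (auto intro!: eq_matI simp: rot_def)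
  then have "1\<^sub>m (2 ^ N) \<in> word_ops N \<alpha> \<beta> [s]"
    using Cons.prems by (auto simp: word_ops_singleton)
  with Cons have "1\<^sub>m (2 ^ N) * 1\<^sub>m (2 ^ N) \<in> word_ops N \<alpha> \<beta> ([s] @ w)"
    unfolding word_ops_append by (intro CollectI exI conjI[OF HOL.refl]) auto
  then show ?case by simp
qed

lemma word_ops_pair:
  assumes "s \<in> {1..<2 * N}" "t \<in> {1..<2 * N}"
  shows "word_ops N \<alpha> \<beta> [s, t] =
    {rot (2 ^ N) (slot_string N \<alpha> \<beta> t) b * rot (2 ^ N) (slot_string N \<alpha> \<beta> s) a | a b. True}"
  using word_ops_append[of N \<alpha> \<beta> "[s]" "[t]"] assms by (auto simp: word_ops_singleton)

lemma word_ops_triple: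
  assumes "s \<in> {1..<2 * N}" "t \<in> {1..<2 * N}"
  shows "word_ops N \<alpha> \<beta> [s, t, s] =
    {rot (2 ^ N) (slot_string N \<alpha> \<beta> s) a * rot (2 ^ N) (slot_string N \<alpha> \<beta> t) b
       * rot (2 ^ N) (slot_string N \<alpha> \<beta> s) c | a b c. True}"
proof -
  note A = assoc_mult_mat[OF rot_carrier[OF slot_string_carrier] rot_carrier[OF slot_string_carrier]
      rot_carrier[OF slot_string_carrier], of N \<alpha> \<beta>]
  show ?thesis
    unfolding A
    using word_ops_append[of N \<alpha> \<beta> "[s, t]" "[s]"] assms
    by (auto simp: word_ops_singleton word_ops_pair A)
qed

text \<open>The monoid has a letter for every natural number. Both sides of each relation contain
  the same letters, so outside the slots the relation holds between empty sets.\<close>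

lemma word_ops_eq_empty: "\<not> set w \<subseteq> {1..<2 * N} \<Longrightarrow> word_ops N \<alpha> \<beta> w = {}"
  by (auto simp: word_ops_def list_all2_conv_all_nth gate_in_slot_iff in_set_conv_nth subset_eq)

text \<open>Closure under contexts is immediate because the operators of a concatenation depend only
  on the operator sets of its parts. The condition \<open>\<alpha> \<noteq> \<beta>\<close> enters
  through the anticommutation behind the braid relation.\<close>

lemma word_ops_cong:
  assumes "hecke_eq u v" "\<alpha> \<noteq> \<beta>"
  shows "word_ops N \<alpha> \<beta> u = word_ops N \<alpha> \<beta> v"
  using assms(1)
proof induction
  case (congr u v x y)
  then show ?case by (simp only: word_ops_append)
next
  case (idem s)
  show ?case
  proof (cases "s \<in> {1..<2 * N}")
    case True
    \<comment> \<open>For the converse inclusion, one of the two gates is given angle 0.\<close>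
    then show ?thesis
      by (auto simp: word_ops_pair word_ops_singleton rot_add slot_string_carrier slot_string_square)
        (metis add_0)
  qed (simp add: word_ops_eq_empty)
next
  case (commute s t)
  show ?case
  proof (cases "s \<in> {1..<2 * N} \<and> t \<in> {1..<2 * N}")
    case True
    have "rot (2 ^ N) (slot_string N \<alpha> \<beta> s) a * rot (2 ^ N) (slot_string N \<alpha> \<beta> t) b =
      rot (2 ^ N) (slot_string N \<alpha> \<beta> t) b * rot (2 ^ N) (slot_string N \<alpha> \<beta> s) a" for a b
      by (intro rot_commute slot_string_carrier slot_string_commute commute)
    then show ?thesis using True by (auto simp: word_ops_pair)
  next
    case False
    then show ?thesis by (subst (1 2) word_ops_eq_empty) auto
  qed
next
  case (braid s)
  show ?case
  proof (cases "s \<in> {1..<2 * N} \<and> Suc s \<in> {1..<2 * N}")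
    case True
    then have P: "slot_string N \<alpha> \<beta> s * slot_string N \<alpha> \<beta> (Suc s) =
        (- 1) \<cdot>\<^sub>m (slot_string N \<alpha> \<beta> (Suc s) * slot_string N \<alpha> \<beta> s)"
      using assms by (intro slot_string_anticommute) auto
    then have Q: "slot_string N \<alpha> \<beta> (Suc s) * slot_string N \<alpha> \<beta> s =
        (- 1) \<cdot>\<^sub>m (slot_string N \<alpha> \<beta> s * slot_string N \<alpha> \<beta> (Suc s))"
      by (simp add: smult_smult_mat) (auto intro!: eq_matI)
    note C = slot_string_carrier slot_string_square
    have s: "s \<in> {1..<2 * N}" "Suc s \<in> {1..<2 * N}" using True by auto
    show ?thesis
      unfolding word_ops_triple[OF s] word_ops_triple[OF s(2,1)]
    proof (intro equalityI subsetI; elim CollectE exE conjE; hypsubst)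
      fix a b c
      show "rot (2 ^ N) (slot_string N \<alpha> \<beta> s) a * rot (2 ^ N) (slot_string N \<alpha> \<beta> (Suc s)) b
          * rot (2 ^ N) (slot_string N \<alpha> \<beta> s) c
        \<in> {rot (2 ^ N) (slot_string N \<alpha> \<beta> (Suc s)) a * rot (2 ^ N) (slot_string N \<alpha> \<beta> s) b
          * rot (2 ^ N) (slot_string N \<alpha> \<beta> (Suc s)) c | a b c. True}"
        using rot_turnover[OF C C P] by simp
      show "rot (2 ^ N) (slot_string N \<alpha> \<beta> (Suc s)) a * rot (2 ^ N) (slot_string N \<alpha> \<beta> s) b
          * rot (2 ^ N) (slot_string N \<alpha> \<beta> (Suc s)) c
        \<in> {rot (2 ^ N) (slot_string N \<alpha> \<beta> s) a * rot (2 ^ N) (slot_string N \<alpha> \<beta> (Suc s)) b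
          * rot (2 ^ N) (slot_string N \<alpha> \<beta> s) c | a b c. True}"
        using rot_turnover[OF C C Q] by simp
    qed
  next
    case False
    then show ?thesis by (subst (1 2) word_ops_eq_empty) auto
  qed
qed auto

section \<open>The monoid generated by all gates\<close>

definition reachable :: "nat \<Rightarrow> pauli \<Rightarrow> pauli \<Rightarrow> complex mat set" where
  "reachable N \<alpha> \<beta> = \<Union> (word_ops N \<alpha> \<beta> ` lists {1..<2 * N})"

lemma reachable_mult:
  assumes "A \<in> reachable N \<alpha> \<beta>" "B \<in> reachable N \<alpha> \<beta>"
  shows "A * B \<in> reachable N \<alpha> \<beta>"
proof -
  obtain u v where u: "u \<in> lists {1..<2 * N}" "A \<in> word_ops N \<alpha> \<beta> u"
    and v: "v \<in> lists {1..<2 * N}" "B \<in> word_ops N \<alpha> \<beta> v"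
    using assms by (auto simp: reachable_def)
  then have "A * B \<in> word_ops N \<alpha> \<beta> (v @ u)" by (auto simp: word_ops_append)
  moreover have "v @ u \<in> lists {1..<2 * N}" using u v by simp
  ultimately show ?thesis unfolding reachable_def by blast
qed

lemma reachable_mat_prod:
  "set As \<subseteq> reachable N \<alpha> \<beta> \<Longrightarrow> mat_prod (2 ^ N) As \<in> reachable N \<alpha> \<beta>"
proof (induction As)
  case Nil
  have "1\<^sub>m (2 ^ N) \<in> word_ops N \<alpha> \<beta> []" by (simp add: word_ops_Nil)
  then show ?case unfolding reachable_def mat_prod_simps by blast
qed (simp add: reachable_mult)

lemma gate_op_reachable:
  assumes "gate_in_slot N \<alpha> \<beta> s g"
  shows "gate_op N g \<in> reachable N \<alpha> \<beta>"
proof -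
  have "list_all2 (gate_in_slot N \<alpha> \<beta>) [s] [g]" using assms by simp
  then have "circuit_op N [g] \<in> word_ops N \<alpha> \<beta> [s]" and "gate_op N g \<in> carrier_mat (2 ^ N) (2 ^ N)"
    using gate_ops_carrier[of N \<alpha> \<beta> "[s]" "[g]"] unfolding word_ops_def by auto
  then have "gate_op N g \<in> word_ops N \<alpha> \<beta> [s]"
    by (simp add: circuit_op_def right_mult_one_mat[of _ "2 ^ N" "2 ^ N"])
  moreover have "[s] \<in> lists {1..<2 * N}" using assms by (auto simp: gate_in_slot_iff)
  ultimately show ?thesis unfolding reachable_def by blast
qed

lemma trotter_step_reachable: "trotter_step N \<alpha> \<beta> J h \<Delta>t t \<in> reachable N \<alpha> \<beta>"
proof -
  have "gate_op N (Rot2 \<alpha> i \<theta>) \<in> reachable N \<alpha> \<beta>" if "i \<in> set [1..<N]" for i \<theta>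
    using that by (intro gate_op_reachable[of _ _ _ "2 * i"]) (auto simp: gate_in_slot_def)
  moreover have "gate_op N (Rot1 \<beta> i \<theta>) \<in> reachable N \<alpha> \<beta>" if "i \<in> set [1..<N + 1]" for i \<theta>
    using that by (intro gate_op_reachable[of _ _ _ "2 * i - 1"]) (auto simp: gate_in_slot_def)
  ultimately show ?thesis
    unfolding trotter_step_def by (intro reachable_mult reachable_mat_prod) (auto simp del: gate_op.simps)
qed

lemma trotter_evolution_reachable: "trotter_evolution N \<alpha> \<beta> J h t0 \<Delta>t nt \<in> reachable N \<alpha> \<beta>"
  unfolding trotter_evolution_def by (intro reachable_mat_prod) (auto intro: trotter_step_reachable)

lemma triangle_word_letters: "set (triangle_word n n) \<subseteq> {1..<Suc n}"
  by (auto simp: triangle_word_def)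

text \<open>Run a triangle with all angles 0 before the given circuit: the operator is unchanged,
  and the combined word is absorbed into the triangle word.\<close>

lemma reachable_subset_triangle:
  assumes "N \<ge> 1" "\<alpha> \<noteq> \<beta>"
  shows "reachable N \<alpha> \<beta> \<subseteq> word_ops N \<alpha> \<beta> (triangle_word (2 * N - 1) (2 * N - 1))"
proof
  let ?T = "triangle_word (2 * N - 1) (2 * N - 1)"
  have n: "Suc (2 * N - 1) = 2 * N" using assms by simp
  fix A assume "A \<in> reachable N \<alpha> \<beta>"
  then obtain w where w: "set w \<subseteq> {1..<2 * N}" and A: "A \<in> word_ops N \<alpha> \<beta> w"
    by (auto simp: reachable_def)
  have "A = A * 1\<^sub>m (2 ^ N)" using A word_ops_carrier[of N \<alpha> \<beta> w] by fastforce
  moreover have "1\<^sub>m (2 ^ N) \<in> word_ops N \<alpha> \<beta> ?T"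
    using triangle_word_letters[of "2 * N - 1"] n by (intro one_mem_word_ops) simp
  ultimately have "A \<in> word_ops N \<alpha> \<beta> (?T @ w)" using A by (auto simp: word_ops_append)
  also have "\<dots> = word_ops N \<alpha> \<beta> ?T"
    using w assms(2) by (intro word_ops_cong triangle_word_absorbs) fastforce
  finally show "A \<in> word_ops N \<alpha> \<beta> ?T" .
qed

section \<open>Square and triangle circuits\<close>

lemma list_all2_concat:
  "list_all2 P (concat ws) c \<longleftrightarrow> (\<exists>bs. c = concat bs \<and> list_all2 (list_all2 P) ws bs)"
proof (induction ws arbitrary: c)
  case (Cons w ws)
  show ?case
  proof
    assume "list_all2 P (concat (w # ws)) c"
    then obtain c1 c2 where "c = c1 @ c2" "list_all2 P w c1" "list_all2 P (concat ws) c2"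
      by (auto simp: list_all2_append1)
    with Cons show "\<exists>bs. c = concat bs \<and> list_all2 (list_all2 P) (w # ws) bs"
      by (metis concat.simps(2) list.rel_intros(2))
  next
    assume "\<exists>bs. c = concat bs \<and> list_all2 (list_all2 P) (w # ws) bs"
    with Cons show "list_all2 P (concat (w # ws)) c"
      by (fastforce simp: list_all2_Cons1 intro!: list_all2_appendI)
  qed
qed simp

lemma triangle_circuit_iff:
  assumes "N \<ge> 1"
  shows "triangle_circuit N \<alpha> \<beta> c \<longleftrightarrow>
    list_all2 (gate_in_slot N \<alpha> \<beta>) (triangle_word (2 * N - 1) (2 * N - 1)) c"
proof -
  have n: "Suc (2 * N - 1) = 2 * N" using assms by simp
  have "cascade N \<alpha> \<beta> = (\<lambda>k. list_all2 (gate_in_slot N \<alpha> \<beta>) [2 * N - k..<2 * N])"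
    by (intro ext) (simp add: cascade_def)
  then show ?thesis
    unfolding triangle_circuit_def triangle_word_def n list_all2_concat list_all2_map1 by simp
qed

text \<open>The increasing order of slots is one admissible order inside each layer.\<close>

lemma square_circuit_if_brick_word:
  assumes "N \<ge> 1" "list_all2 (gate_in_slot N \<alpha> \<beta>) (brick_word N) c"
  shows "square_circuit N \<alpha> \<beta> c"
proof -
  obtain bs where c: "c = concat bs" and bs: "list_all2 (list_all2 (gate_in_slot N \<alpha> \<beta>))
      (replicate N (filter odd [1..<2 * N] @ filter even [1..<2 * N])) bs"
    using assms(2) unfolding brick_word_def list_all2_concat by blast
  have "square_block N \<alpha> \<beta> b" if "b \<in> set bs" for b
  proof -
    have "list_all2 (gate_in_slot N \<alpha> \<beta>) (filter odd [1..<2 * N] @ filter even [1..<2 * N]) b"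
      using bs that by (auto simp: list_all2_conv_all_nth in_set_conv_nth)
    then obtain c1 c2 where "b = c1 @ c2" "list_all2 (gate_in_slot N \<alpha> \<beta>) (filter odd [1..<2 * N]) c1"
      "list_all2 (gate_in_slot N \<alpha> \<beta>) (filter even [1..<2 * N]) c2"
      by (auto simp: list_all2_append1)
    moreover have "layer N \<alpha> \<beta> {s \<in> {1..2 * N - 1}. Q s} c"
      if "list_all2 (gate_in_slot N \<alpha> \<beta>) (filter Q [1..<2 * N]) c" for Q c
      unfolding layer_def using that by (intro exI[of _ "filter Q [1..<2 * N]"]) auto
    ultimately show ?thesis unfolding square_block_def by blast
  qed
  moreover have "length bs = N" using bs by (auto dest: list_all2_lengthD)
  ultimately show ?thesis unfolding square_circuit_def using c by blast
qed

section \<open>Counting gates by the parity of their slots\<close>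

lemma card_odd_slots: "card {s \<in> {1..2 * N - 1}. odd s} = N"
proof -
  have "{s \<in> {1..2 * N - 1}. odd s} = (\<lambda>j. 2 * j + 1) ` {..<N}"
    by (auto elim!: oddE)
  then show ?thesis by (simp add: card_image inj_on_def)
qed

lemma card_even_slots: "card {s \<in> {1..2 * N - 1}. even s} = N - 1"
proof -
  have "{s \<in> {1..2 * N - 1}. even s} = (\<lambda>j. 2 * j) ` {1..N - 1}"
    by (auto elim!: evenE)
  then show ?thesis by (simp add: card_image inj_on_def)
qed

text \<open>The order inside a layer is arbitrary, so the word is only asserted to exist; its parity
  counts do not depend on that order.\<close>

lemma square_block_word:
  assumes "square_block N \<alpha> \<beta> b"
  shows "\<exists>w. list_all2 (gate_in_slot N \<alpha> \<beta>) w b \<and>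
    length (filter odd w) = N \<and> length (filter even w) = N - 1"
proof -
  obtain c1 c2 u v where b: "b = c1 @ c2" and u: "distinct u" "set u = {s \<in> {1..2 * N - 1}. odd s}"
    and v: "distinct v" "set v = {s \<in> {1..2 * N - 1}. even s}"
    and c: "list_all2 (gate_in_slot N \<alpha> \<beta>) u c1" "list_all2 (gate_in_slot N \<alpha> \<beta>) v c2"
    using assms unfolding square_block_def layer_def by blast
  have "length u = N" "length v = N - 1"
    using distinct_card[OF u(1)] distinct_card[OF v(1)] by (simp_all only: u v card_odd_slots card_even_slots)
  moreover have "filter odd u = u" "filter even u = []" "filter even v = v" "filter odd v = []"
    using u(2) v(2) by (auto simp: filter_id_conv filter_empty_conv)
  ultimately show ?thesis
    using b c by (intro exI[of _ "u @ v"]) (simp add: list_all2_appendI)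
qed

lemma square_circuit_word:
  assumes "square_circuit N \<alpha> \<beta> c"
  shows "\<exists>w. list_all2 (gate_in_slot N \<alpha> \<beta>) w c \<and>
    length (filter odd w) = N * N \<and> length (filter even w) = N * (N - 1)"
proof -
  obtain bs where c: "c = concat bs" and l: "length bs = N" and bs: "\<forall>b\<in>set bs. square_block N \<alpha> \<beta> b"
    using assms unfolding square_circuit_def by blast
  from bs have "\<exists>w. list_all2 (gate_in_slot N \<alpha> \<beta>) w (concat bs) \<and>
    length (filter odd w) = length bs * N \<and> length (filter even w) = length bs * (N - 1)"
  proof (induction bs)
    case (Cons b bs)
    then obtain w where "list_all2 (gate_in_slot N \<alpha> \<beta>) w (concat bs)"
      "length (filter odd w) = length bs * N" "length (filter even w) = length bs * (N - 1)" by auto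
    moreover obtain v where "list_all2 (gate_in_slot N \<alpha> \<beta>) v b"
      "length (filter odd v) = N" "length (filter even v) = N - 1"
      using square_block_word Cons.prems by (metis list.set_intros(1))
    ultimately show ?case by (intro exI[of _ "v @ w"]) (simp add: list_all2_appendI)
  qed simp
  then show ?thesis using c l by simp
qed

lemma cascade_counts:
  assumes "odd n" "2 * r < n"
  shows "length (filter odd [n - 2 * r..<Suc n]) = r + 1 \<and> length (filter even [n - 2 * r..<Suc n]) = r"
  using assms(2)
proof (induction r)
  case 0
  show ?case using assms(1) by simp
next
  case (Suc r)
  define a where "a = n - 2 * Suc r"
  have a: "n - 2 * r = Suc (Suc a)" "a \<le> n" "Suc a \<le> n" using Suc.prems by (auto simp: a_def)
  have "odd a" using Suc.prems assms(1) by (simp add: a_def)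
  moreover have "[a..<Suc n] = a # Suc a # [n - 2 * r..<Suc n]"
    using a by (simp add: upt_conv_Cons del: upt_Suc)
  ultimately show ?case using Suc unfolding a_def[symmetric] by (simp del: upt_Suc)
qed

text \<open>Cascades are added in pairs, one of even and one of odd length. A pair adds 2 r + 3 odd
  slots, the difference of consecutive squares, and 2 r + 2 even slots.\<close>

lemma triangle_word_counts:
  assumes "odd n" "2 * r < n"
  shows "length (filter odd (triangle_word n (2 * r + 1))) = (r + 1) * (r + 1) \<and>
    length (filter even (triangle_word n (2 * r + 1))) = (r + 1) * r"
  using assms(2)
proof (induction r)
  case 0
  show ?case using assms(1) by (simp add: triangle_word_def)
next
  case (Suc r)
  define a where "a = n - Suc (2 * r)"
  have a: "n - 2 * r = Suc a" "a \<le> n" "n - Suc (Suc (2 * r)) = n - 2 * Suc r"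
    using Suc.prems by (auto simp: a_def)
  have "even a" using Suc.prems assms(1) by (simp add: a_def)
  moreover have "[a..<Suc n] = a # [n - 2 * r..<Suc n]"
    using a by (simp add: upt_conv_Cons del: upt_Suc)
  moreover have "triangle_word n (2 * Suc r + 1) =
      triangle_word n (2 * r + 1) @ [a..<Suc n] @ [n - 2 * Suc r..<Suc n]"
    using a(3) by (simp add: triangle_word_Suc a_def del: upt_Suc)
  ultimately show ?case
    using Suc cascade_counts[OF assms(1), of r] cascade_counts[OF assms(1), of "Suc r"]
    by (simp del: upt_Suc)
qed

lemma gate_counts:
  assumes "list_all2 (gate_in_slot N \<alpha> \<beta>) w c"
  shows "length (filter (\<lambda>g. \<exists>i\<in>{1..N}. \<exists>\<theta>. g = Rot1 \<beta> i \<theta>) c) = length (filter odd w) \<and>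
    length (filter (\<lambda>g. \<exists>i\<in>{1..N - 1}. \<exists>\<theta>. g = Rot2 \<alpha> i \<theta>) c) = length (filter even w)"
  using assms
proof induction
  case (Cons s w g c)
  have "(\<exists>i\<in>{1..N}. \<exists>\<theta>. g = Rot1 \<beta> i \<theta>) \<longleftrightarrow> odd s"
    "(\<exists>i\<in>{1..N - 1}. \<exists>\<theta>. g = Rot2 \<alpha> i \<theta>) \<longleftrightarrow> even s"
    using Cons.hyps(1) unfolding gate_in_slot_def by (elim disjE bexE exE conjE; simp)+
  then show ?case using Cons.IH by (simp del: bex_simps ex_simps)
qed simp

lemma circuit_counts:
  assumes "N \<ge> 1" "square_circuit N \<alpha> \<beta> c \<or> triangle_circuit N \<alpha> \<beta> c"
  shows "length c = N * (2 * N - 1) \<and>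
    length (filter (\<lambda>g. \<exists>i\<in>{1..N}. \<exists>\<theta>. g = Rot1 \<beta> i \<theta>) c) = N ^ 2 \<and>
    length (filter (\<lambda>g. \<exists>i\<in>{1..N - 1}. \<exists>\<theta>. g = Rot2 \<alpha> i \<theta>) c) = N * (N - 1)"
proof -
  have "length (filter odd (triangle_word (2 * N - 1) (2 * N - 1))) = N * N \<and>
      length (filter even (triangle_word (2 * N - 1) (2 * N - 1))) = N * (N - 1)"
    using triangle_word_counts[of "2 * N - 1" "N - 1"] assms(1) by (cases N) simp_all
  then obtain w where w: "list_all2 (gate_in_slot N \<alpha> \<beta>) w c"
    "length (filter odd w) = N * N" "length (filter even w) = N * (N - 1)"
    using assms square_circuit_word triangle_circuit_iff by metis
  have "length c = N * N + N * (N - 1)"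
    using w sum_length_filter_compl[of odd w] list_all2_lengthD[OF w(1)] by simp
  also have "\<dots> = N * (2 * N - 1)" by (cases N) simp_all
  finally show ?thesis using gate_counts[OF w(1)] w(2,3) by (simp add: power2_eq_square del: bex_simps ex_simps)
qed

theorem mainTheorem6:
  fixes N nt :: nat and \<alpha> \<beta> :: pauli
    and J h :: "nat \<Rightarrow> real \<Rightarrow> real" and H :: "real \<Rightarrow> complex mat"
    and t0 \<Delta>t :: real and U :: "complex mat"
  assumes "N \<ge> 2" and "\<alpha> \<noteq> \<beta>"
    and "\<And>t. H t = tfim_hamiltonian N \<alpha> \<beta> J h t"
    and "\<Delta>t > 0" and "nt > N"
    and "U = trotter_evolution N \<alpha> \<beta> J h t0 \<Delta>t nt"
  shows "(\<exists>c. square_circuit N \<alpha> \<beta> c \<and> circuit_op N c = U) \<and>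
    (\<exists>c. triangle_circuit N \<alpha> \<beta> c \<and> circuit_op N c = U) \<and>
    (\<forall>c. square_circuit N \<alpha> \<beta> c \<or> triangle_circuit N \<alpha> \<beta> c \<longrightarrow>
       length c = N * (2 * N - 1) \<and>
       length (filter (\<lambda>g. \<exists>i\<in>{1..N}. \<exists>\<theta>. g = Rot1 \<beta> i \<theta>) c) = N ^ 2 \<and>
       length (filter (\<lambda>g. \<exists>i\<in>{1..N - 1}. \<exists>\<theta>. g = Rot2 \<alpha> i \<theta>) c) = N * (N - 1)) \<and>
    (\<forall>c. square_circuit N \<alpha> \<beta> c \<longrightarrow>
       (\<exists>d. triangle_circuit N \<alpha> \<beta> d \<and> circuit_op N d = circuit_op N c)) \<and>
    (\<forall>d. triangle_circuit N \<alpha> \<beta> d \<longrightarrow>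
       (\<exists>c. square_circuit N \<alpha> \<beta> c \<and> circuit_op N c = circuit_op N d))"
proof -
  let ?T = "triangle_word (2 * N - 1) (2 * N - 1)"
  have N: "N \<ge> 1" using assms(1) by simp
  have triangle: "\<exists>c. triangle_circuit N \<alpha> \<beta> c \<and> circuit_op N c = A" if "A \<in> reachable N \<alpha> \<beta>" for A
    using that reachable_subset_triangle[OF N assms(2)]
    by (auto simp: word_ops_def triangle_circuit_iff[OF N])
  have square: "\<exists>c. square_circuit N \<alpha> \<beta> c \<and> circuit_op N c = A" if "A \<in> reachable N \<alpha> \<beta>" for A
  proof -
    have "A \<in> word_ops N \<alpha> \<beta> (brick_word N)"
      using that reachable_subset_triangle[OF N assms(2)]
        word_ops_cong[OF brick_word_hecke_eq_triangle_word[OF assms(1)] assms(2)] by auto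
    then show ?thesis using square_circuit_if_brick_word[OF N] by (auto simp: word_ops_def)
  qed
  \<comment> \<open>A circuit of either shape follows some word of slots, so its operator lies in
    the generated monoid; conversion between the shapes passes through that monoid.\<close>
  have reach: "circuit_op N c \<in> reachable N \<alpha> \<beta>"
    if c: "square_circuit N \<alpha> \<beta> c \<or> triangle_circuit N \<alpha> \<beta> c" for c
  proof -
    obtain w where "list_all2 (gate_in_slot N \<alpha> \<beta>) w c"
      using c square_circuit_word triangle_circuit_iff[OF N] by blast
    then have "circuit_op N c \<in> word_ops N \<alpha> \<beta> w" by (auto simp: word_ops_def)
    moreover from this have "w \<in> lists {1..<2 * N}" using word_ops_eq_empty[of w N \<alpha> \<beta>] by auto
    ultimately show ?thesis by (auto simp: reachable_def)
  qed
  show ?thesis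
    unfolding assms(6)
    by (intro conjI allI impI)
      (use triangle square reach circuit_counts[OF N] trotter_evolution_reachable in \<open>blast | fast\<close>)+
qed

end
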